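(* Let $\sigma>\frac12$ be fixed and let $V=\{V_n\}_{n\in\mathbb Z}$ be a real-valued sequence with $V\in l^1_{2\sigma-1}$. Let $H=-\Delta+V$ on $l^2(\mathbb Z)$ and let $R(\lambda)=(-\Delta+V-\lambda)^{-1}$ be its resolvent. Then for every fixed $\omega\in(0,4)$ and each choice of sign $\pm$, $$\sup_{0<\varepsilon\le 1}\|R(\omega\pm i\varepsilon)\|_{B(\sigma,-\sigma)}<\infty .$$ As a consequence, the limits $R^{\pm}(\omega)=\lim_{\varepsilon\downarrow 0}R(\omega\pm i\varepsilon)$ exist in the norm of $B(\sigma,-\sigma)$.
   Context: For a sequence $\phi=\{\phi_n\}_{n\in\mathbb Z}$, $(-\Delta\phi)_n=-(\phi_{n+1}+\phi_{n-1}-2\phi_n)$ and $(V\phi)_n=V_n\phi_n$, so $(H\phi)_n=-(\phi_{n+1}+\phi_{n-1}-2\phi_n)+V_n\phi_n$. For $\sigma\in\mathbb R$, $l^2_\sigma$ is the space of complex sequences on $\mathbb Z$ with $\|u\|_{l^2_\sigma}=\left(\sum_{n\in\mathbb Z}(1+n^2)^{\sigma}|u_n|^2\right)^{1/2}<\infty$, and $l^1_\sigma$ is the space with $\|u\|_{l^1_\sigma}=\sum_{n\in\mathbb Z}(1+n^2)^{\sigma/2}|u_n|<\infty$. $B(\sigma,\sigma')$ denotes the bounded linear operators from $l^2_\sigma$ to $l^2_{\sigma'}$ with the operator norm. Since $H$ is bounded and self-adjoint on $l^2$, $R(\lambda)$ is a bounded operator on $l^2$ for every non-real $\lambda$; it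 is viewed as an operator $l^2_\sigma\to l^2_{-\sigma}$ by restriction. *)

theory Defs
  imports "HOL-Analysis.Analysis"
begin

definition weighted_l2 :: "real \<Rightarrow> (int \<Rightarrow> complex) set" where
  "weighted_l2 \<sigma> =
     {u. (\<lambda>n. (1 + (real_of_int n)\<^sup>2) powr \<sigma> * (cmod (u n))\<^sup>2) summable_on UNIV}"

definition weighted_l2_norm :: "real \<Rightarrow> (int \<Rightarrow> complex) \<Rightarrow> real" where
  "weighted_l2_norm \<sigma> u =
     sqrt (\<Sum>\<^sub>\<infinity>n\<in>UNIV. (1 + (real_of_int n)\<^sup>2) powr \<sigma> * (cmod (u n))\<^sup>2)"

definition weighted_l1 :: "real \<Rightarrow> (int \<Rightarrow> complex) set" where
  "weighted_l1 \<sigma> =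
     {u. (\<lambda>n. (1 + (real_of_int n)\<^sup>2) powr (\<sigma> / 2) * cmod (u n)) summable_on UNIV}"

text \<open>
  Operators are total functions on sequences; only their values on
  \<^term>\<open>weighted_l2 \<sigma>\<close> matter in the following two definitions, so that
  restriction to that space is implicit.
\<close>

definition bounded_ops ::
    "real \<Rightarrow> real \<Rightarrow> ((int \<Rightarrow> complex) \<Rightarrow> (int \<Rightarrow> complex)) set" where
  "bounded_ops \<sigma> \<sigma>' =
     {T. (\<forall>u\<in>weighted_l2 \<sigma>. T u \<in> weighted_l2 \<sigma>') \<and>
         (\<forall>u\<in>weighted_l2 \<sigma>. \<forall>v\<in>weighted_l2 \<sigma>. T (\<lambda>n. u n + v n) = (\<lambda>n. T u n + T v n)) \<and>
         (\<forall>c. \<forall>u\<in>weighted_l2 \<sigma>. T (\<lambda>n. c * u n) = (\<lambda>n. c * T u n)) \<and>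
         (\<exists>C. \<forall>u\<in>weighted_l2 \<sigma>. weighted_l2_norm \<sigma>' (T u) \<le> C * weighted_l2_norm \<sigma> u)}"

text \<open>
  The operator norm, meaningful for members of \<^term>\<open>bounded_ops \<sigma> \<sigma>'\<close>.  As for
  \<^const>\<open>onorm\<close>, the zero sequence contributes the harmless quotient \<open>0 / 0 = 0\<close>.
\<close>

definition op_norm ::
    "real \<Rightarrow> real \<Rightarrow> ((int \<Rightarrow> complex) \<Rightarrow> (int \<Rightarrow> complex)) \<Rightarrow> real" where
  "op_norm \<sigma> \<sigma>' T =
     (SUP u\<in>weighted_l2 \<sigma>. weighted_l2_norm \<sigma>' (T u) / weighted_l2_norm \<sigma> u)"

definition schroedinger :: "(int \<Rightarrow> real) \<Rightarrow> (int \<Rightarrow> complex) \<Rightarrow> (int \<Rightarrow> complex)" where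
  "schroedinger V \<phi> =
     (\<lambda>n. - (\<phi> (n + 1) + \<phi> (n - 1) - 2 * \<phi> n) + complex_of_real (V n) * \<phi> n)"

text \<open>
  The inverse of \<open>H - z\<close> on unweighted \<open>l\<^sup>2\<close>, which is \<^term>\<open>weighted_l2 0\<close>.  It is the
  resolvent whenever \<open>H - z\<close> is a bijection of that space, as it is for non-real \<open>z\<close>
  and bounded real \<open>V\<close>; arguments outside \<open>l\<^sup>2\<close> are irrelevant.
\<close>

definition resolvent ::
    "(int \<Rightarrow> real) \<Rightarrow> complex \<Rightarrow> (int \<Rightarrow> complex) \<Rightarrow> (int \<Rightarrow> complex)" where
  "resolvent V z = inv_into (weighted_l2 0) (\<lambda>u n. schroedinger V u n - z * u n)"

end

theory Submission
  imports Defs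
begin

text \<open>
  Write the spectral parameter as \<open>z = 2 - \<zeta> - 1 / \<zeta>\<close> with \<open>\<bar>\<zeta>\<bar> \<le> 1\<close>.  As \<open>z\<close> runs through
  \<open>\<omega> \<plusminus> i\<epsilon>\<close> with \<open>0 \<le> \<epsilon> \<le> 1\<close>, \<open>\<zeta>\<close> runs through a compact curve that avoids the real axis.  Since
  \<open>V\<close> is summable, the Jost solutions exist, are bounded after removal of the free exponentials,
  and depend continuously on \<open>\<zeta>\<close> up to the unit circle; since \<open>V\<close> is real, their Wronskian does not
  vanish.  Hence the Green function is bounded uniformly in \<open>\<epsilon>\<close> and both of its arguments and
  continuous in \<open>\<epsilon>\<close> down to \<open>0\<close>.  For \<open>\<sigma> > 1/2\<close> the weights are summable, so bounded kernels are
  Hilbert--Schmidt from exponent \<open>\<sigma>\<close> to \<open>- \<sigma>\<close>, and dominated convergence gives convergence in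
  Hilbert--Schmidt norm.
\<close>

section \<open>Jost solutions\<close>

text \<open>The constant of the free Green function: without a potential, \<open>green\<close> below
  is \<open>jost_coeff \<zeta> * \<zeta> ^ nat \<bar>n - k\<bar>\<close>.\<close>

definition jost_coeff :: "complex \<Rightarrow> complex" where
  "jost_coeff \<zeta> = \<zeta> / (1 - \<zeta>\<^sup>2)"

text \<open>
  Variation of constants: a solution is written as \<open>\<zeta>\<^sup>n (a\<^sub>n + b\<^sub>n)\<close>, where in the absence of
  a potential \<open>a\<close> is constant and \<open>b\<^sub>n\<close> is proportional to \<open>\<zeta>\<close> to the power \<open>- 2 n\<close>.  Passing from
  \<open>n\<close> to \<open>n - 1\<close>, the free part of the step is then a contraction for \<open>\<bar>\<zeta>\<bar> \<le> 1\<close>, so no Volterra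
  equation has to be solved.
\<close>

definition jost_step ::
    "(int \<Rightarrow> real) \<Rightarrow> complex \<Rightarrow> int \<Rightarrow> complex \<times> complex \<Rightarrow> complex \<times> complex" where
  "jost_step V \<zeta> n x =
     (fst x + jost_coeff \<zeta> * V n * (fst x + snd x),
      \<zeta>\<^sup>2 * (snd x - jost_coeff \<zeta> * V n * (fst x + snd x)))"

text \<open>The pair \<open>(1, 0)\<close> is placed at \<open>n + j\<close> and carried back to
  \<open>n\<close>. As steps without potential fix \<open>(1, 0)\<close>, this is the pair for the
  potential cut off beyond \<open>n + j\<close>.\<close>

primrec jost_approx ::
    "(int \<Rightarrow> real) \<Rightarrow> complex \<Rightarrow> nat \<Rightarrow> int \<Rightarrow> complex \<times> complex" where
  "jost_approx V \<zeta> 0 n = (1, 0)"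
| "jost_approx V \<zeta> (Suc j) n = jost_step V \<zeta> (n + 1) (jost_approx V \<zeta> j (n + 1))"

definition jost_pair :: "(int \<Rightarrow> real) \<Rightarrow> complex \<Rightarrow> int \<Rightarrow> complex \<times> complex" where
  "jost_pair V \<zeta> n = lim (\<lambda>j. jost_approx V \<zeta> j n)"

text \<open>\<open>jost\<close> and \<open>jost_left\<close> are the Jost solutions with the factors \<open>\<zeta>\<^sup>n\<close> at \<open>+\<infinity>\<close>, respectively
  \<open>\<zeta>\<close> to the power \<open>- n\<close> at \<open>-\<infinity>\<close>, divided out.\<close>

definition jost :: "(int \<Rightarrow> real) \<Rightarrow> complex \<Rightarrow> int \<Rightarrow> complex" where
  "jost V \<zeta> n = fst (jost_pair V \<zeta> n) + snd (jost_pair V \<zeta> n)"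

section \<open>Growth of the steps and convergence of the approximations\<close>

lemma jost_step_diff:
  "jost_step V \<zeta> n x - jost_step V \<zeta> n y = jost_step V \<zeta> n (x - y)"
  by (simp add: jost_step_def prod_eq_iff algebra_simps)

lemma norm_fst_plus_snd_le: "norm (fst x + snd x) \<le> 2 * norm (x :: complex \<times> complex)"
  by (smt (verit) norm_fst_le norm_snd_le norm_triangle_ineq prod.collapse)

lemma norm_jost_correction:
  assumes "cmod \<zeta> \<le> 1" "cmod (jost_coeff \<zeta>) \<le> C"
  shows "norm (jost_coeff \<zeta> * V * m, - (\<zeta>\<^sup>2 * (jost_coeff \<zeta> * V * m))) \<le> 2 * C * cmod V * cmod m"
proof -
  have "norm (jost_coeff \<zeta> * V * m, - (\<zeta>\<^sup>2 * (jost_coeff \<zeta> * V * m)))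
      \<le> cmod (jost_coeff \<zeta> * V * m) + cmod (- (\<zeta>\<^sup>2 * (jost_coeff \<zeta> * V * m)))"
    by (rule norm_Pair_le)
  also have "cmod (- (\<zeta>\<^sup>2 * (jost_coeff \<zeta> * V * m))) \<le> cmod (jost_coeff \<zeta> * V * m)"
    using assms(1) by (simp add: norm_mult norm_power power_le_one mult_left_le_one_le)
  also have "cmod (jost_coeff \<zeta> * V * m) + cmod (jost_coeff \<zeta> * V * m) \<le> 2 * C * cmod V * cmod m"
    using mult_right_mono[OF assms(2), of "cmod V * cmod m"] by (simp add: norm_mult mult_ac)
  finally show ?thesis by simp
qed

text \<open>The free part multiplies the second component by \<open>\<zeta>\<^sup>2\<close> and
  keeps the first, so it does not enlarge the norm, even on the unit circle; all growth comes from
  the potential.\<close>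

lemma norm_jost_step_le:
  assumes "cmod \<zeta> \<le> 1" "cmod (jost_coeff \<zeta>) \<le> C"
  shows "norm (jost_step V \<zeta> n x) \<le> (1 + 4 * C * \<bar>V n\<bar>) * norm x"
proof -
  have C: "0 \<le> C" using assms(2) norm_ge_zero order_trans by blast
  let ?m = "fst x + snd x"
  have "jost_step V \<zeta> n x
      = (fst x, \<zeta>\<^sup>2 * snd x) + (jost_coeff \<zeta> * V n * ?m, - (\<zeta>\<^sup>2 * (jost_coeff \<zeta> * V n * ?m)))"
    by (simp add: jost_step_def algebra_simps)
  then have "norm (jost_step V \<zeta> n x) \<le> norm (fst x, \<zeta>\<^sup>2 * snd x)
      + norm (jost_coeff \<zeta> * V n * ?m, - (\<zeta>\<^sup>2 * (jost_coeff \<zeta> * V n * ?m)))"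
    using norm_triangle_ineq by metis
  also have "norm (fst x, \<zeta>\<^sup>2 * snd x) \<le> norm x"
  proof -
    have "cmod (\<zeta>\<^sup>2 * snd x) \<le> cmod (snd x)"
      using assms(1) by (simp add: norm_mult norm_power power_le_one mult_left_le_one_le)
    then show ?thesis
      by (cases x) (auto simp: norm_Pair intro!: real_sqrt_le_mono power_mono)
  qed
  also have "norm (jost_coeff \<zeta> * V n * ?m, - (\<zeta>\<^sup>2 * (jost_coeff \<zeta> * V n * ?m)))
      \<le> 2 * C * \<bar>V n\<bar> * cmod ?m"
    using norm_jost_correction[OF assms, of "V n" ?m] by simp
  also have "\<dots> \<le> 2 * C * \<bar>V n\<bar> * (2 * norm x)"
    by (intro mult_left_mono norm_fst_plus_snd_le) (use C in auto)
  finally show ?thesis by (simp add: algebra_simps)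
qed

lemma norm_jost_step_unit_le:
  assumes "cmod \<zeta> \<le> 1" "cmod (jost_coeff \<zeta>) \<le> C"
  shows "norm (jost_step V \<zeta> n (1, 0) - (1, 0)) \<le> 4 * C * \<bar>V n\<bar>"
proof -
  have C: "0 \<le> C" using assms(2) norm_ge_zero order_trans by blast
  have "jost_step V \<zeta> n (1, 0) - (1, 0)
      = (jost_coeff \<zeta> * V n * 1, - (\<zeta>\<^sup>2 * (jost_coeff \<zeta> * V n * 1)))"
    by (simp add: jost_step_def)
  then have "norm (jost_step V \<zeta> n (1, 0) - (1, 0)) \<le> 2 * C * \<bar>V n\<bar>"
    using norm_jost_correction[OF assms, of "V n" 1] by simp
  also have "\<dots> \<le> 4 * C * \<bar>V n\<bar>" using C by (simp add: mult_right_mono)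
  finally show ?thesis .
qed

text \<open>Discrete Gronwall: consecutive approximations differ by the step at
  \<open>n + 1 + j\<close> applied to \<open>(1, 0)\<close>. By linearity this defect passes through
  the other \<open>j\<close> steps, each costing a factor of the form \<open>1 + x\<close>, at most
  \<open>exp x\<close>.\<close>

lemma norm_jost_approx_diff_le:
  assumes "cmod \<zeta> \<le> 1" "cmod (jost_coeff \<zeta>) \<le> C"
  shows "norm (jost_approx V \<zeta> (Suc j) n - jost_approx V \<zeta> j n)
    \<le> exp (4 * C * (\<Sum>i<j. \<bar>V (n + 1 + int i)\<bar>)) * (4 * C * \<bar>V (n + 1 + int j)\<bar>)"
proof (induction j arbitrary: n)
  case 0
  then show ?case using norm_jost_step_unit_le[OF assms, of V "n + 1"] by simp
next
  case (Suc j)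
  have C: "0 \<le> C" using assms(2) norm_ge_zero order_trans by blast
  let ?E = "exp (4 * C * (\<Sum>i<j. \<bar>V (n + 2 + int i)\<bar>))"
  have "norm (jost_approx V \<zeta> (Suc (Suc j)) n - jost_approx V \<zeta> (Suc j) n)
      = norm (jost_step V \<zeta> (n + 1)
          (jost_approx V \<zeta> (Suc j) (n + 1) - jost_approx V \<zeta> j (n + 1)))"
    by (simp only: jost_approx.simps(2) jost_step_diff)
  also have "\<dots> \<le> (1 + 4 * C * \<bar>V (n + 1)\<bar>)
      * norm (jost_approx V \<zeta> (Suc j) (n + 1) - jost_approx V \<zeta> j (n + 1))"
    by (rule norm_jost_step_le[OF assms])
  also have "\<dots> \<le> exp (4 * C * \<bar>V (n + 1)\<bar>) * (?E * (4 * C * \<bar>V (n + 2 + int j)\<bar>))"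
    by (intro mult_mono exp_ge_add_one_self) (use Suc.IH[of "n + 1"] C in \<open>auto simp: add_ac\<close>)
  also have "\<dots> = exp (4 * C * (\<Sum>i<Suc j. \<bar>V (n + 1 + int i)\<bar>))
      * (4 * C * \<bar>V (n + 1 + int (Suc j))\<bar>)"
    by (simp only: sum.lessThan_Suc_shift) (simp add: exp_add [symmetric] algebra_simps)
  finally show ?case .
qed

lemma summable_shift_nat:
  fixes f :: "int \<Rightarrow> real"
  assumes "f summable_on UNIV"
  shows "summable (\<lambda>i. f (n + int i))"
proof -
  have "f summable_on (range (\<lambda>i::nat. n + int i))"
    by (rule summable_on_subset_banach[OF assms]) auto
  then have "(f \<circ> (\<lambda>i. n + int i)) summable_on UNIV"
    by (subst (asm) summable_on_reindex) (auto simp: inj_def)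
  then show ?thesis by (auto dest: summable_on_imp_summable simp: o_def)
qed

lemma sum_shift_le_infsum:
  fixes f :: "int \<Rightarrow> real"
  assumes "f summable_on UNIV" "\<And>n. 0 \<le> f n"
  shows "(\<Sum>i<j. f (n + int i)) \<le> infsum f UNIV"
proof -
  have "(\<Sum>i<j. f (n + int i)) = sum f ((\<lambda>i. n + int i) ` {..<j})"
    by (subst sum.reindex) (auto simp: inj_on_def)
  also have "\<dots> \<le> infsum f UNIV"
    by (rule finite_sum_le_infsum) (use assms in auto)
  finally show ?thesis .
qed

lemma summable_on_abs_real:
  fixes V :: "int \<Rightarrow> real"
  assumes "V summable_on UNIV"
  shows "(\<lambda>n. \<bar>V n\<bar>) summable_on UNIV"
  using assms summable_on_iff_abs_summable_on_real[of V UNIV] by simp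

text \<open>One constant for all \<open>n\<close>: the exponential dominates every product of step
  factors, and \<open>4 * C\<close> comes from the defect of a single step at
  \<open>(1, 0)\<close>.\<close>

definition jost_bound :: "(int \<Rightarrow> real) \<Rightarrow> real \<Rightarrow> real" where
  "jost_bound V C = exp (4 * C * (\<Sum>\<^sub>\<infinity>n. \<bar>V n\<bar>)) * (4 * C)"

lemma jost_bound_nonneg: "0 \<le> C \<Longrightarrow> 0 \<le> jost_bound V C"
  by (simp add: jost_bound_def)

lemma norm_jost_approx_diff_le':
  assumes "cmod \<zeta> \<le> 1" "cmod (jost_coeff \<zeta>) \<le> C" "V summable_on UNIV"
  shows "norm (jost_approx V \<zeta> (Suc j) n - jost_approx V \<zeta> j n)
    \<le> jost_bound V C * \<bar>V (n + 1 + int j)\<bar>"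
proof -
  have C: "0 \<le> C" using assms(2) norm_ge_zero order_trans by blast
  note norm_jost_approx_diff_le[OF assms(1,2), of V j n]
  also have "exp (4 * C * (\<Sum>i<j. \<bar>V (n + 1 + int i)\<bar>)) * (4 * C * \<bar>V (n + 1 + int j)\<bar>)
     \<le> exp (4 * C * (\<Sum>\<^sub>\<infinity>n. \<bar>V n\<bar>)) * (4 * C * \<bar>V (n + 1 + int j)\<bar>)"
    using sum_shift_le_infsum[OF summable_on_abs_real[OF assms(3)], of "n + 1" j] C
    by (intro mult_right_mono) (auto intro!: mult_left_mono)
  finally show ?thesis by (simp add: jost_bound_def)
qed

lemma jost_approx_telescope:
  "(\<Sum>j<N. jost_approx V \<zeta> (Suc j) n - jost_approx V \<zeta> j n) + (1, 0) = jost_approx V \<zeta> N n"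
  using sum_lessThan_telescope[of "\<lambda>j. jost_approx V \<zeta> j n" N] by simp

text \<open>Weierstrass M-test for the telescoping series, with a multiple of the shifted potential
  as majorant. The uniformity in \<open>\<zeta>\<close> is what later carries continuity over to the
  limit.\<close>

lemma jost_approx_uniform_limit:
  assumes "\<And>\<zeta>. \<zeta> \<in> S \<Longrightarrow> cmod \<zeta> \<le> 1 \<and> cmod (jost_coeff \<zeta>) \<le> C" "V summable_on UNIV"
  shows "uniform_limit S (\<lambda>j \<zeta>. jost_approx V \<zeta> j n) (\<lambda>\<zeta>. jost_pair V \<zeta> n) sequentially"
proof -
  let ?D = "\<lambda>j \<zeta>. jost_approx V \<zeta> (Suc j) n - jost_approx V \<zeta> j n"
  have "uniform_limit S (\<lambda>N \<zeta>. \<Sum>j<N. ?D j \<zeta>) (\<lambda>\<zeta>. \<Sum>j. ?D j \<zeta>) sequentially"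
  proof (rule Weierstrass_m_test)
    show "norm (?D j \<zeta>) \<le> jost_bound V C * \<bar>V (n + 1 + int j)\<bar>" if "\<zeta> \<in> S" for j \<zeta>
      using norm_jost_approx_diff_le'[of \<zeta> C V j n] assms that by blast
    show "summable (\<lambda>j. jost_bound V C * \<bar>V (n + 1 + int j)\<bar>)"
      using summable_shift_nat[OF summable_on_abs_real[OF assms(2)], of "n + 1"]
      by (intro summable_mult) simp
  qed
  then have "uniform_limit S (\<lambda>N \<zeta>. (\<Sum>j<N. ?D j \<zeta>) + (1, 0)) (\<lambda>\<zeta>. (\<Sum>j. ?D j \<zeta>) + (1, 0)) sequentially"
    by (intro uniform_limit_intros)
  then have *: "uniform_limit S (\<lambda>N \<zeta>. jost_approx V \<zeta> N n) (\<lambda>\<zeta>. (\<Sum>j. ?D j \<zeta>) + (1, 0)) sequentially"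
    by (simp only: jost_approx_telescope)
  have "(\<Sum>j. ?D j \<zeta>) + (1, 0) = jost_pair V \<zeta> n" if "\<zeta> \<in> S" for \<zeta>
    unfolding jost_pair_def
    using tendsto_uniform_limitI[OF * that] by (simp add: limI)
  then show ?thesis
    using * by (simp cong: uniform_limit_cong')
qed

lemma jost_approx_tendsto:
  assumes "cmod \<zeta> \<le> 1" "V summable_on UNIV"
  shows "(\<lambda>j. jost_approx V \<zeta> j n) \<longlonglongrightarrow> jost_pair V \<zeta> n"
  using jost_approx_uniform_limit[of "{\<zeta>}" "cmod (jost_coeff \<zeta>)" V n] assms
  by (auto intro: tendsto_uniform_limitI)

lemma jost_pair_step:
  assumes "cmod \<zeta> \<le> 1" "V summable_on UNIV"
  shows "jost_pair V \<zeta> n = jost_step V \<zeta> (n + 1) (jost_pair V \<zeta> (n + 1))"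
proof (rule LIMSEQ_unique)
  show "(\<lambda>j. jost_approx V \<zeta> (Suc j) n) \<longlonglongrightarrow> jost_pair V \<zeta> n"
    using jost_approx_tendsto[OF assms] by (rule LIMSEQ_Suc)
  show "(\<lambda>j. jost_approx V \<zeta> (Suc j) n) \<longlonglongrightarrow> jost_step V \<zeta> (n + 1) (jost_pair V \<zeta> (n + 1))"
    unfolding jost_approx.simps jost_step_def
    by (intro tendsto_intros jost_approx_tendsto assms)
qed

text \<open>Summing the telescoping differences leaves the tail of the potential beyond
  \<open>n\<close>. The tail is kept because its decay gives the normalisation at +\<infinity> in
  \<open>jost_tendsto_1\<close>.\<close>

lemma norm_jost_pair_le:
  assumes "cmod \<zeta> \<le> 1" "cmod (jost_coeff \<zeta>) \<le> C" "V summable_on UNIV"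
  shows "norm (jost_pair V \<zeta> n - (1, 0)) \<le> jost_bound V C * (\<Sum>j. \<bar>V (n + 1 + int j)\<bar>)"
proof (rule LIMSEQ_le_const2)
  have C: "0 \<le> C" using assms(2) norm_ge_zero order_trans by blast
  have sm: "summable (\<lambda>j. \<bar>V (n + 1 + int j)\<bar>)"
    using summable_shift_nat[OF summable_on_abs_real[OF assms(3)], of "n + 1"] by simp
  show "(\<lambda>j. norm (jost_approx V \<zeta> j n - (1, 0))) \<longlonglongrightarrow> norm (jost_pair V \<zeta> n - (1, 0))"
    by (intro tendsto_intros jost_approx_tendsto assms)
  have "norm (jost_approx V \<zeta> N n - (1, 0)) \<le> jost_bound V C * (\<Sum>j. \<bar>V (n + 1 + int j)\<bar>)" for N
  proof -
    have "jost_approx V \<zeta> N n - (1, 0) = (\<Sum>j<N. jost_approx V \<zeta> (Suc j) n - jost_approx V \<zeta> j n)"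
      by (simp flip: jost_approx_telescope[of V \<zeta> n N])
    also have "norm \<dots> \<le> (\<Sum>j<N. jost_bound V C * \<bar>V (n + 1 + int j)\<bar>)"
      by (rule sum_norm_le) (rule norm_jost_approx_diff_le'[OF assms])
    also have "\<dots> \<le> jost_bound V C * (\<Sum>j. \<bar>V (n + 1 + int j)\<bar>)"
      unfolding sum_distrib_left[symmetric]
      using C sm by (intro mult_left_mono sum_le_suminf) (auto simp: jost_bound_def)
    finally show ?thesis .
  qed
  then show "\<exists>N. \<forall>j\<ge>N. norm (jost_approx V \<zeta> j n - (1, 0)) \<le> jost_bound V C * (\<Sum>j. \<bar>V (n + 1 + int j)\<bar>)"
    by blast
qed

lemma norm_jost_le:
  assumes "cmod \<zeta> \<le> 1" "cmod (jost_coeff \<zeta>) \<le> C" "V summable_on UNIV"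
  shows "cmod (jost V \<zeta> n) \<le> 1 + 2 * jost_bound V C * (\<Sum>\<^sub>\<infinity>n. \<bar>V n\<bar>)"
proof -
  have C: "0 \<le> C" using assms(2) norm_ge_zero order_trans by blast
  have "(\<Sum>j. \<bar>V (n + 1 + int j)\<bar>) \<le> (\<Sum>\<^sub>\<infinity>n. \<bar>V n\<bar>)"
  proof (rule suminf_le_const)
    show "summable (\<lambda>j. \<bar>V (n + 1 + int j)\<bar>)"
      by (rule summable_shift_nat[OF summable_on_abs_real[OF assms(3)], of "n + 1"])
    show "(\<Sum>j<N. \<bar>V (n + 1 + int j)\<bar>) \<le> (\<Sum>\<^sub>\<infinity>n. \<bar>V n\<bar>)" for N
      by (rule sum_shift_le_infsum[OF summable_on_abs_real[OF assms(3)]]) simp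
  qed
  then have "norm (jost_pair V \<zeta> n - (1, 0)) \<le> jost_bound V C * (\<Sum>\<^sub>\<infinity>n. \<bar>V n\<bar>)"
    using norm_jost_pair_le[OF assms, of n] mult_left_mono[OF _ jost_bound_nonneg[OF C]]
    by (meson order_trans)
  moreover have "cmod (jost V \<zeta> n - 1) \<le> 2 * norm (jost_pair V \<zeta> n - (1, 0))"
    using norm_fst_plus_snd_le[of "jost_pair V \<zeta> n - (1, 0)"] by (simp add: jost_def algebra_simps)
  moreover have "cmod (jost V \<zeta> n) \<le> 1 + cmod (jost V \<zeta> n - 1)"
    using norm_triangle_ineq[of 1 "jost V \<zeta> n - 1"] by simp
  ultimately show ?thesis by linarith
qed

lemma jost_tendsto_1:
  assumes "cmod \<zeta> \<le> 1" "V summable_on UNIV"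
  shows "(\<lambda>k. jost V \<zeta> (int k)) \<longlonglongrightarrow> 1"
proof -
  have sm: "summable (\<lambda>j. \<bar>V (1 + int j)\<bar>)"
    using summable_shift_nat[OF summable_on_abs_real[OF assms(2)], of 1] by simp
  have "(\<lambda>k. \<Sum>j. \<bar>V (1 + int (j + k))\<bar>) \<longlonglongrightarrow> 0"
    using tendsto_diff[OF tendsto_const summable_LIMSEQ[OF sm], of "\<Sum>j. \<bar>V (1 + int j)\<bar>"]
    by (subst suminf_minus_initial_segment[OF sm]) simp
  then have "(\<lambda>k. jost_bound V (cmod (jost_coeff \<zeta>)) * (\<Sum>j. \<bar>V (int k + 1 + int j)\<bar>)) \<longlonglongrightarrow> jost_bound V (cmod (jost_coeff \<zeta>)) * 0"
    by (intro tendsto_intros) (simp add: algebra_simps)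
  then have lim: "(\<lambda>k. jost_bound V (cmod (jost_coeff \<zeta>)) * (\<Sum>j. \<bar>V (int k + 1 + int j)\<bar>)) \<longlonglongrightarrow> 0"
    by simp
  have "(\<lambda>k. jost_pair V \<zeta> (int k) - (1, 0)) \<longlonglongrightarrow> 0"
    by (rule Lim_null_comparison[OF always_eventually lim])
      (intro allI norm_jost_pair_le[OF assms(1) order_refl assms(2)])
  then have "(\<lambda>k. jost_pair V \<zeta> (int k)) \<longlonglongrightarrow> (1, 0)"
    by (rule LIM_zero_cancel)
  from tendsto_add[OF tendsto_fst[OF this] tendsto_snd[OF this]] show ?thesis
    by (simp add: jost_def)
qed

lemma continuous_on_jost:
  assumes "\<And>\<zeta>. \<zeta> \<in> S \<Longrightarrow> cmod \<zeta> \<le> 1 \<and> \<zeta>\<^sup>2 \<noteq> 1 \<and> cmod (jost_coeff \<zeta>) \<le> C" "V summable_on UNIV"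
  shows "continuous_on S (\<lambda>\<zeta>. jost V \<zeta> n)"
proof -
  have c: "continuous_on S jost_coeff"
    unfolding jost_coeff_def by (intro continuous_intros) (use assms(1) in auto)
  have "continuous_on S (\<lambda>\<zeta>. jost_approx V \<zeta> j n)" for j n
  proof (induction j arbitrary: n)
    case (Suc j)
    then show ?case by (auto simp: jost_step_def intro!: continuous_intros c)
  qed simp
  then have "continuous_on S (\<lambda>\<zeta>. jost_pair V \<zeta> n)"
    by (intro uniform_limit_theorem[OF _ jost_approx_uniform_limit]) (use assms in auto)
  then show ?thesis
    unfolding jost_def by (intro continuous_intros)
qed

text \<open>The eigenvalue equation for \<open>\<zeta> powi n * jost V \<zeta> n\<close> at energy
  \<open>2 - \<zeta> - 1 / \<zeta>\<close>, divided by \<open>\<zeta> powi n\<close>. Both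
  neighbours are expressed through the pair \<open>(a, b)\<close> at \<open>n\<close>.\<close>

lemma jost_recurrence:
  assumes "cmod \<zeta> \<le> 1" "V summable_on UNIV" "\<zeta>\<^sup>2 \<noteq> 1" "\<zeta> \<noteq> 0"
  shows "jost V \<zeta> (n - 1) / \<zeta> + \<zeta> * jost V \<zeta> (n + 1) = (\<zeta> + 1 / \<zeta> + V n) * jost V \<zeta> n"
proof -
  define c where "c = jost_coeff \<zeta>"
  have c: "c * (1 - \<zeta>\<^sup>2) = \<zeta>" using assms(3) by (simp add: c_def jost_coeff_def)
  obtain a b a' b' where ab: "jost_pair V \<zeta> n = (a, b)" "jost_pair V \<zeta> (n + 1) = (a', b')"
    by (meson surj_pair)
  have 1: "jost V \<zeta> (n - 1) = (a + c * V n * (a + b)) + \<zeta>\<^sup>2 * (b - c * V n * (a + b))"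
    using jost_pair_step[OF assms(1,2), of "n - 1"] ab by (simp add: jost_def jost_step_def c_def)
  have 2: "a = a' + c * V (n + 1) * (a' + b')" "b = \<zeta>\<^sup>2 * (b' - c * V (n + 1) * (a' + b'))"
    using jost_pair_step[OF assms(1,2), of n] ab by (simp_all add: jost_def jost_step_def c_def)
  \<comment> \<open>The terms with \<open>V (n + 1)\<close> have opposite signs and cancel, so the
    forward neighbour depends on the pair at \<open>n\<close> alone.\<close>
  have "\<zeta>\<^sup>2 * (a' + b') = \<zeta>\<^sup>2 * a + b"
    unfolding 2 by (simp add: algebra_simps)
  then have 3: "\<zeta>\<^sup>2 * jost V \<zeta> (n + 1) = \<zeta>\<^sup>2 * a + b" by (simp add: jost_def ab)
  have "jost V \<zeta> (n - 1) + \<zeta>\<^sup>2 * jost V \<zeta> (n + 1)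
      = (1 + \<zeta>\<^sup>2) * (a + b) + (c * (1 - \<zeta>\<^sup>2)) * V n * (a + b)"
    unfolding 1 3 by (simp add: algebra_simps)
  \<comment> \<open>The normalisation of \<open>jost_coeff\<close> makes the potential term exactly
    \<open>\<zeta> * V n\<close>.\<close>
  also have "\<dots> = (\<zeta>\<^sup>2 + 1 + \<zeta> * V n) * jost V \<zeta> n"
    unfolding c by (simp add: jost_def ab algebra_simps)
  finally have 4: "jost V \<zeta> (n - 1) + \<zeta>\<^sup>2 * jost V \<zeta> (n + 1) = (\<zeta>\<^sup>2 + 1 + \<zeta> * V n) * jost V \<zeta> n" .
  have "jost V \<zeta> (n - 1) / \<zeta> + \<zeta> * jost V \<zeta> (n + 1)
      = (jost V \<zeta> (n - 1) + \<zeta>\<^sup>2 * jost V \<zeta> (n + 1)) / \<zeta>"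
    using assms(4) by (simp add: add_divide_distrib power2_eq_square)
  also have "\<dots> = (\<zeta> + 1 / \<zeta> + V n) * jost V \<zeta> n"
    unfolding 4 using assms(4) by (simp add: add_divide_distrib power2_eq_square ring_distribs)
  finally show ?thesis .
qed

section \<open>The left Jost solution, the Wronskian and the Green kernel\<close>

definition jost_left :: "(int \<Rightarrow> real) \<Rightarrow> complex \<Rightarrow> int \<Rightarrow> complex" where
  "jost_left V \<zeta> n = jost (\<lambda>k. V (- k)) \<zeta> (- n)"

text \<open>This is \<open>f (n + 1) * g n - f n * g (n + 1)\<close> for the full solutions
  \<open>f n = \<zeta> powi n * jost V \<zeta> n\<close> and
  \<open>g n = \<zeta> powi (- n) * jost_left V \<zeta> n\<close>; the exponentials combine to
  \<open>\<zeta>\<close> and \<open>1 / \<zeta>\<close>.\<close>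

definition wronskian :: "(int \<Rightarrow> real) \<Rightarrow> complex \<Rightarrow> int \<Rightarrow> complex" where
  "wronskian V \<zeta> n = \<zeta> * jost V \<zeta> (n + 1) * jost_left V \<zeta> n - jost V \<zeta> n * jost_left V \<zeta> (n + 1) / \<zeta>"

text \<open>Up to a factor 2i, the Wronskian of \<open>u\<close> and its complex conjugate.\<close>

definition current :: "(int \<Rightarrow> complex) \<Rightarrow> int \<Rightarrow> real" where
  "current u n = Im (cnj (u n) * u (n + 1))"

text \<open>Right solution at the larger index times left solution at the smaller one, over their
  Wronskian; the exponentials merge into a power of the distance. The sign is that of the inverse of
  \<open>H - z\<close> with the Wronskian as above.\<close>

definition green :: "(int \<Rightarrow> real) \<Rightarrow> complex \<Rightarrow> int \<Rightarrow> int \<Rightarrow> complex" where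
  "green V \<zeta> n k =
     - (\<zeta> ^ nat \<bar>n - k\<bar> * jost V \<zeta> (max n k) * jost_left V \<zeta> (min n k) / wronskian V \<zeta> 0)"

lemma summable_reflect:
  fixes f :: "int \<Rightarrow> real"
  assumes "f summable_on UNIV"
  shows "(\<lambda>n. f (- n)) summable_on UNIV"
  using assms summable_on_reindex_bij_betw[of uminus UNIV UNIV f] by (simp add: bij_uminus)

lemma infsum_reflect:
  fixes f :: "int \<Rightarrow> real"
  shows "(\<Sum>\<^sub>\<infinity>n. f (- n)) = infsum f UNIV"
  using infsum_reindex_bij_betw[of uminus UNIV UNIV f] by (simp add: bij_uminus)

lemma jost_left_recurrence:
  assumes "cmod \<zeta> \<le> 1" "V summable_on UNIV" "\<zeta>\<^sup>2 \<noteq> 1" "\<zeta> \<noteq> 0"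
  shows "jost_left V \<zeta> (n + 1) / \<zeta> + \<zeta> * jost_left V \<zeta> (n - 1)
    = (\<zeta> + 1 / \<zeta> + V n) * jost_left V \<zeta> n"
proof -
  have e: "- (n + 1) = - n - 1" "- (n - 1) = - n + 1" by auto
  show ?thesis
    using jost_recurrence[OF assms(1) summable_reflect[OF assms(2)] assms(3,4), of "- n"]
    unfolding jost_left_def e by simp
qed

lemma norm_jost_left_le:
  assumes "cmod \<zeta> \<le> 1" "cmod (jost_coeff \<zeta>) \<le> C" "V summable_on UNIV"
  shows "cmod (jost_left V \<zeta> n) \<le> 1 + 2 * jost_bound V C * (\<Sum>\<^sub>\<infinity>n. \<bar>V n\<bar>)"
  using norm_jost_le[OF assms(1,2) summable_reflect[OF assms(3)], of "- n"]
    infsum_reflect[of "\<lambda>n. \<bar>V n\<bar>"]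
  by (simp add: jost_left_def jost_bound_def)

text \<open>Both recurrences at \<open>n\<close> have the same coefficient, which cancels when the
  values at \<open>n - 1\<close> are traded for those at \<open>n + 1\<close>.\<close>

lemma wronskian_const:
  assumes "cmod \<zeta> \<le> 1" "V summable_on UNIV" "\<zeta>\<^sup>2 \<noteq> 1" "\<zeta> \<noteq> 0"
  shows "wronskian V \<zeta> n = wronskian V \<zeta> 0"
proof -
  have step: "wronskian V \<zeta> (n - 1) = wronskian V \<zeta> n" for n
  proof -
    let ?E = "\<zeta> + 1 / \<zeta> + V n"
    have l: "\<zeta> * jost_left V \<zeta> (n - 1) = ?E * jost_left V \<zeta> n - jost_left V \<zeta> (n + 1) / \<zeta>"
      using jost_left_recurrence[OF assms, of n] by (metis add_diff_cancel_left')
    have r: "jost V \<zeta> (n - 1) / \<zeta> = ?E * jost V \<zeta> n - \<zeta> * jost V \<zeta> (n + 1)"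
      using jost_recurrence[OF assms, of n] by (metis add_diff_cancel_right')
    have "wronskian V \<zeta> (n - 1)
        = jost V \<zeta> n * (\<zeta> * jost_left V \<zeta> (n - 1)) - jost V \<zeta> (n - 1) / \<zeta> * jost_left V \<zeta> n"
      by (simp add: wronskian_def)
    also have "\<dots> = wronskian V \<zeta> n"
      unfolding l r by (simp add: wronskian_def ring_distribs)
    finally show ?thesis .
  qed
  show ?thesis
  proof (induction n rule: int_induct[where k = 0])
    case (step1 i)
    then show ?case using step[of "i + 1"] by simp
  next
    case (step2 i)
    then show ?case using step[of i] by simp
  qed simp
qed

section \<open>The current and the Wronskian\<close>

text \<open>Multiplying the equation by \<open>cnj (u n)\<close> and taking imaginary parts removes
  the real \<open>v\<close>; of the coefficient only \<open>Im z\<close> survives.\<close>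

lemma current_diff:
  assumes "u (n + 1) + u (n - 1) = (2 + complex_of_real v - z) * u n"
  shows "current u n - current u (n - 1) = - Im z * (cmod (u n))\<^sup>2"
proof -
  have "current u n - current u (n - 1) = Im (cnj (u n) * (u (n + 1) + u (n - 1)))"
    by (simp add: current_def algebra_simps)
  also have "\<dots> = Im ((2 + complex_of_real v - z) * (u n * cnj (u n)))"
    unfolding assms by (simp add: mult_ac)
  also have "\<dots> = - Im z * (cmod (u n))\<^sup>2"
    by (simp flip: complex_norm_square)
  finally show ?thesis .
qed

lemma int_antimonoI:
  fixes g :: "int \<Rightarrow> real"
  assumes "\<And>n. g n \<le> g (n - 1)" "a \<le> b"
  shows "g b \<le> g a"
  using assms(2)
proof (induction b rule: int_ge_induct)
  case (step i)
  then show ?case using assms(1)[of "i + 1"] by simp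
qed simp

text \<open>The factor in parentheses vanishes on the unit circle and is positive inside, so there
  the energy lies in the same half plane as \<open>\<zeta>\<close>.\<close>

lemma Im_spectral_parameter:
  assumes "Im \<zeta> \<noteq> 0"
  shows "Im (2 - \<zeta> - 1 / \<zeta>) = Im \<zeta> * (1 / (cmod \<zeta>)\<^sup>2 - 1)"
  by (simp add: Im_divide cmod_power2 algebra_simps)

lemma Im_neq_0_imp:
  assumes "Im \<zeta> \<noteq> 0"
  shows "\<zeta> \<noteq> 0" "\<zeta>\<^sup>2 \<noteq> 1"
  using assms by (auto simp: power2_eq_1_iff)

text \<open>
  If the Wronskian vanished, the two Jost solutions would be proportional.  Their currents have
  opposite signs near \<open>+\<infinity>\<close> and \<open>-\<infinity>\<close>, which contradicts the monotonicity of the current.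
\<close>

lemma wronskian_nonzero:
  assumes "cmod \<zeta> \<le> 1" "V summable_on UNIV" "Im \<zeta> \<noteq> 0"
  shows "wronskian V \<zeta> 0 \<noteq> 0"
proof
  note z = Im_neq_0_imp[OF assms(3)]
  note rec = assms(1,2) z(2,1)
  assume "wronskian V \<zeta> 0 = 0"
  then have W0: "wronskian V \<zeta> n = 0" for n
    using wronskian_const[OF rec, of n] by simp
  have ImR: "Im (complex_of_real r * w) = r * Im w" for r w by simp
  \<comment> \<open>Multiplication by \<open>s\<close> treats both half planes at once.\<close>
  define s where "s = sgn (Im \<zeta>)"
  define f where "f n = \<zeta> powi n * jost V \<zeta> n" for n
  define g where "g n = \<zeta> powi (- n) * jost_left V \<zeta> n" for n
  define V' where "V' = (\<lambda>k. V (- k))"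
  have f1: "f (n + 1) = \<zeta> powi n * (\<zeta> * jost V \<zeta> (n + 1))" for n
    using z(1) by (simp add: f_def power_int_add)
  have f2: "f (n - 1) = \<zeta> powi n * (jost V \<zeta> (n - 1) / \<zeta>)" for n
    using z(1) by (simp add: f_def power_int_diff)
  have g1: "g (n + 1) = \<zeta> powi (- n) * (jost_left V \<zeta> (n + 1) / \<zeta>)" for n
    using z(1) power_int_diff[of \<zeta> "- n" 1] by (simp add: g_def)
  have "f (n + 1) * g n - f n * g (n + 1)
      = \<zeta> powi n * \<zeta> powi (- n) * wronskian V \<zeta> n" for n
    unfolding f1 g1 by (simp add: f_def g_def wronskian_def algebra_simps)
  then have W: "f (n + 1) * g n = f n * g (n + 1)" for n
    by (simp add: W0)
  \<comment> \<open>Proportionality of \<open>f\<close> and \<open>g\<close> in a form without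
    division, since either may vanish at single points.\<close>
  have cross: "(cmod (g n))\<^sup>2 * current f n = (cmod (f n))\<^sup>2 * current g n" for n
  proof -
    have "(cmod (g n))\<^sup>2 * current f n = Im (complex_of_real ((cmod (g n))\<^sup>2) * (cnj (f n) * f (n + 1)))"
      unfolding current_def ImR ..
    also have "complex_of_real ((cmod (g n))\<^sup>2) * (cnj (f n) * f (n + 1))
        = cnj (g n) * cnj (f n) * (f (n + 1) * g n)"
      unfolding complex_norm_square by (simp add: mult_ac)
    also have "\<dots> = complex_of_real ((cmod (f n))\<^sup>2) * (cnj (g n) * g (n + 1))"
      unfolding W complex_norm_square by (simp add: mult_ac)
    also have "Im \<dots> = (cmod (f n))\<^sup>2 * current g n"
      unfolding current_def ImR ..
    finally show ?thesis .
  qed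
  have sz: "0 \<le> s * Im (2 - \<zeta> - 1 / \<zeta>)"
  proof -
    have "s * Im (2 - \<zeta> - 1 / \<zeta>) = \<bar>Im \<zeta>\<bar> * (1 / (cmod \<zeta>)\<^sup>2 - 1)"
      unfolding Im_spectral_parameter[OF assms(3)] s_def by (simp add: sgn_if)
    also have "\<dots> \<ge> 0"
      using assms(1) z(1) by (intro mult_nonneg_nonneg) (auto simp: field_simps power_le_one)
    finally show ?thesis .
  qed
  have mono: "s * current f n \<le> s * current f (n - 1)" for n
  proof -
    have "f (n + 1) + f (n - 1) = (2 + complex_of_real (V n) - (2 - \<zeta> - 1 / \<zeta>)) * f n"
      unfolding f1 f2 distrib_left[symmetric] unfolding f_def
      using jost_recurrence[OF rec, of n] by (simp add: add.commute mult_ac)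
    from current_diff[OF this]
    have "s * current f n - s * current f (n - 1) = - (s * Im (2 - \<zeta> - 1 / \<zeta>)) * (cmod (f n))\<^sup>2"
      by (simp only: right_diff_distrib[symmetric]) (simp add: algebra_simps)
    also have "\<dots> \<le> 0" using sz by (intro mult_nonpos_nonneg) auto
    finally show ?thesis by simp
  qed
  have cf: "current f n = (cmod (\<zeta> powi n))\<^sup>2 * Im (\<zeta> * (cnj (jost V \<zeta> n) * jost V \<zeta> (n + 1)))" for n
    unfolding current_def f1 unfolding f_def ImR[symmetric] complex_norm_square
    by (simp add: mult_ac)
  have cg: "current g n = (cmod (\<zeta> powi (- n)))\<^sup>2
      * Im ((cnj (jost_left V \<zeta> n) * jost_left V \<zeta> (n + 1)) / \<zeta>)" for n
    unfolding current_def g1 unfolding g_def ImR[symmetric] complex_norm_square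
    by (simp add: mult_ac)
  have p: "(cmod (\<zeta> powi n))\<^sup>2 > 0" for n using z(1) by simp
  \<comment> \<open>Near +\<infinity> \<open>jost\<close> is close to 1, so the current of
    \<open>f\<close> takes the sign of \<open>Im \<zeta>\<close>.\<close>
  have "(\<lambda>k. s * Im (\<zeta> * (cnj (jost V \<zeta> (int k)) * jost V \<zeta> (int (Suc k)))))
      \<longlonglongrightarrow> s * Im (\<zeta> * (cnj 1 * 1))"
    by (intro tendsto_intros jost_tendsto_1 LIMSEQ_Suc assms)
  then have "\<forall>\<^sub>F k in sequentially. s * Im (\<zeta> * (cnj (jost V \<zeta> (int k)) * jost V \<zeta> (int (Suc k)))) > 0"
    by (rule order_tendstoD) (use assms(3) in \<open>simp add: s_def sgn_if\<close>)
  then obtain k where "s * Im (\<zeta> * (cnj (jost V \<zeta> (int k)) * jost V \<zeta> (int k + 1))) > 0"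
    by (auto simp: eventually_sequentially add.commute)
  then have pos: "s * current f (int k) > 0"
    using p[of "int k"] unfolding cf by (simp add: zero_less_mult_iff mult_less_0_iff)
  \<comment> \<open>Near -\<infinity> the current of \<open>g\<close> takes the sign of
    \<open>Im (1 / \<zeta>)\<close>, the opposite one. The reflection maps the indices
    \<open>k + 1\<close> and \<open>k\<close> to \<open>n\<close> and \<open>n + 1\<close> with
    \<open>n = - k - 1\<close>.\<close>
  have "(\<lambda>k. s * Im (cnj (jost V' \<zeta> (int (Suc k))) * jost V' \<zeta> (int k) / \<zeta>))
      \<longlonglongrightarrow> s * Im (cnj 1 * 1 / \<zeta>)"
    unfolding V'_def
    by (intro tendsto_intros LIMSEQ_Suc[OF jost_tendsto_1] jost_tendsto_1 summable_reflect assms z)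
  moreover have "s * Im (cnj 1 * 1 / \<zeta>) < 0"
    using assms(3) by (simp add: s_def sgn_if Im_divide field_simps add_pos_nonneg zero_less_power2 sum_power2_gt_zero_iff)
  ultimately have "\<forall>\<^sub>F k in sequentially. s * Im (cnj (jost V' \<zeta> (int (Suc k))) * jost V' \<zeta> (int k) / \<zeta>) < 0"
    by (rule order_tendstoD)
  then obtain j where "s * Im (cnj (jost V' \<zeta> (int j + 1)) * jost V' \<zeta> (int j) / \<zeta>) < 0"
    by (auto simp: eventually_sequentially add.commute)
  moreover define n where "n = - int j - 1"
  ultimately have "s * Im ((cnj (jost_left V \<zeta> n) * jost_left V \<zeta> (n + 1)) / \<zeta>) < 0"
    by (simp add: jost_left_def V'_def add.commute)
  then have neg: "s * current g n < 0"
    using p[of "- n"] unfolding cg by (simp add: zero_less_mult_iff mult_less_0_iff)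
  then have "g n \<noteq> 0" by (auto simp: current_def)
  \<comment> \<open>\<open>cross\<close> transfers the sign to the current of \<open>f\<close> at
    \<open>n\<close>. As \<open>n\<close> lies to the left of \<open>k\<close>, monotonicity
    contradicts positivity at \<open>k\<close>.\<close>
  have "(cmod (g n))\<^sup>2 * (s * current f n) = (cmod (f n))\<^sup>2 * (s * current g n)"
    using cross[of n] by (simp add: mult.left_commute)
  also have "\<dots> \<le> 0" using neg by (simp add: mult_nonneg_nonpos)
  finally have "s * current f n \<le> 0"
    using \<open>g n \<noteq> 0\<close> by (simp add: mult_le_0_iff)
  moreover have "s * current f (int k) \<le> s * current f n"
    by (rule int_antimonoI[of "\<lambda>n. s * current f n", OF mono]) (simp add: n_def)
  ultimately show False using pos by simp
qed

section \<open>The Green function and the resolvent\<close>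

lemma weighted_l2_0_iff: "u \<in> weighted_l2 0 \<longleftrightarrow> (\<lambda>n. (cmod (u n))\<^sup>2) summable_on UNIV"
proof -
  have "1 + (real_of_int n)\<^sup>2 \<noteq> 0" for n
    by (smt (verit) zero_le_power2)
  then show ?thesis by (simp add: weighted_l2_def)
qed

section \<open>Uniqueness of square-summable solutions\<close>

lemma l2_tendsto_0:
  assumes "(\<lambda>n. (cmod (u n))\<^sup>2) summable_on UNIV"
  shows "(\<lambda>k. cmod (u (n + int k))) \<longlonglongrightarrow> 0"
proof -
  have "(\<lambda>k. (cmod (u (n + int k)))\<^sup>2) \<longlonglongrightarrow> 0"
    using summable_shift_nat[OF assms, of n] by (rule summable_LIMSEQ_zero)
  from tendsto_real_sqrt[OF this] show ?thesis by simp
qed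

lemma abs_current_le: "\<bar>current u n\<bar> \<le> cmod (u n) * cmod (u (n + 1))"
  unfolding current_def using abs_Im_le_cmod[of "cnj (u n) * u (n + 1)"] by (simp add: norm_mult)

text \<open>The current of a square-summable sequence tends to 0 at both ends, while
  \<open>s\<close> times it falls by \<open>\<bar>Im z\<bar> * (cmod (u n))\<^sup>2\<close> at each
  \<open>n\<close>. The total fall is 0, so every single fall is.\<close>

lemma l2_solution_eq_0:
  assumes "u \<in> weighted_l2 0" "Im z \<noteq> 0"
    and rec: "\<And>n. u (n + 1) + u (n - 1) = (2 + complex_of_real (V n) - z) * u n"
  shows "u n = 0"
proof -
  define s where "s = sgn (Im z)"
  have s: "s * Im z = \<bar>Im z\<bar>" by (simp add: s_def sgn_if)
  have l2: "(\<lambda>n. (cmod (u n))\<^sup>2) summable_on UNIV"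
    using assms(1) by (simp add: weighted_l2_0_iff)
  have l2': "(\<lambda>n. (cmod (u (- n)))\<^sup>2) summable_on UNIV"
    using summable_reflect[OF l2] .
  have diff: "s * current u (n - 1) - s * current u n = \<bar>Im z\<bar> * (cmod (u n))\<^sup>2" for n
  proof -
    have "s * current u (n - 1) - s * current u n = - (s * (current u n - current u (n - 1)))"
      by (simp add: right_diff_distrib)
    also have "\<dots> = (s * Im z) * (cmod (u n))\<^sup>2"
      unfolding current_diff[where u = u, OF rec[of n]] by simp
    finally show ?thesis unfolding s .
  qed
  have anti: "s * current u b \<le> s * current u a" if "a \<le> b" for a b
  proof (rule int_antimonoI[OF _ that])
    show "s * current u n \<le> s * current u (n - 1)" for n
    proof -
      have "0 \<le> \<bar>Im z\<bar> * (cmod (u n))\<^sup>2" by simp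
      then show ?thesis unfolding diff[of n, symmetric] by simp
    qed
  qed
  have top: "(\<lambda>k. current u (0 + int k)) \<longlonglongrightarrow> 0"
  proof (rule Lim_null_comparison[OF always_eventually])
    show "\<forall>k. norm (current u (0 + int k)) \<le> cmod (u (0 + int k)) * cmod (u (1 + int k))"
      using abs_current_le[of u "int k" for k] by (simp add: add.commute)
    show "(\<lambda>k. cmod (u (0 + int k)) * cmod (u (1 + int k))) \<longlonglongrightarrow> 0"
      by (rule tendsto_mult_zero[OF l2_tendsto_0[OF l2] l2_tendsto_0[OF l2]])
  qed
  have bot: "(\<lambda>k. current u (- int k)) \<longlonglongrightarrow> 0"
  proof (rule Lim_null_comparison[OF always_eventually])
    show "\<forall>k. norm (current u (- int k)) \<le> cmod (u (- (0 + int k))) * cmod (u (- (- 1 + int k)))"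
      using abs_current_le[of u "- int k" for k] by (simp add: add.commute)
    show "(\<lambda>k. cmod (u (- (0 + int k))) * cmod (u (- (- 1 + int k)))) \<longlonglongrightarrow> 0"
      by (rule tendsto_mult_zero[OF l2_tendsto_0[OF l2'] l2_tendsto_0[OF l2']])
  qed
  have "(\<lambda>k. s * (current u (- int k) - current u (0 + int k))) \<longlonglongrightarrow> s * (0 - 0)"
    by (intro tendsto_intros top bot)
  \<comment> \<open>By monotonicity the fall from \<open>n - 1\<close> to \<open>n\<close> is at
    most that from \<open>- k\<close> to \<open>k\<close>; the 1 in the threshold ensures
    \<open>- k \<le> n - 1\<close>.\<close>
  moreover have "\<bar>Im z\<bar> * (cmod (u n))\<^sup>2 \<le> s * (current u (- int k) - current u (0 + int k))"
    if "nat \<bar>n\<bar> + 1 \<le> k" for k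
  proof -
    have "- int k \<le> n - 1" "n \<le> int k" using that by auto
    from anti[OF this(1)] anti[OF this(2)] diff[of n] show ?thesis
      unfolding right_diff_distrib by simp
  qed
  ultimately have "\<bar>Im z\<bar> * (cmod (u n))\<^sup>2 \<le> s * (0 - 0)"
    by (intro LIMSEQ_le_const) auto
  then show ?thesis using assms(2) by (auto simp: mult_le_0_iff)
qed

text \<open>Off the diagonal one Jost solution is a common factor and the other satisfies its
  recurrence; on the diagonal the recurrence of \<open>jost_left\<close> leaves the
  Wronskian.\<close>

lemma green_equation:
  assumes "cmod \<zeta> \<le> 1" "V summable_on UNIV" "Im \<zeta> \<noteq> 0"
  shows "(\<zeta> + 1 / \<zeta> + V n) * green V \<zeta> n k - (green V \<zeta> (n + 1) k + green V \<zeta> (n - 1) k)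
    = (if n = k then 1 else 0)"
proof -
  note z = Im_neq_0_imp[OF assms(3)]
  note rec = assms(1,2) z(2,1)
  define W where "W = wronskian V \<zeta> 0"
  have W: "W \<noteq> 0" unfolding W_def by (rule wronskian_nonzero[OF assms])
  define E where "E = \<zeta> + 1 / \<zeta> + V n"
  note r = jost_recurrence[OF rec, of n, folded E_def]
  note l = jost_left_recurrence[OF rec, of n, folded E_def]
  \<comment> \<open>A distance \<open>Suc d\<close> keeps both neighbours of \<open>n\<close> on the
    same closed side of \<open>k\<close>, so no \<open>max\<close> or \<open>min\<close> switches
    its argument.\<close>
  consider "n = k" | d where "n = k + int (Suc d)" | d where "k = n + int (Suc d)"
    by (metis add.commute add_Suc_right add_diff_cancel_left' diff_add_cancel int_ops(1) linorder_neqE zless_iff_Suc_zadd)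
  then have "E * green V \<zeta> n k - (green V \<zeta> (n + 1) k + green V \<zeta> (n - 1) k) = (if n = k then 1 else 0)"
  proof cases
    case 1
    have "E * green V \<zeta> n k - (green V \<zeta> (n + 1) k + green V \<zeta> (n - 1) k)
       = (\<zeta> * jost V \<zeta> (n + 1) * jost_left V \<zeta> n + jost V \<zeta> n * (\<zeta> * jost_left V \<zeta> (n - 1))
          - jost V \<zeta> n * (E * jost_left V \<zeta> n)) / W"
      using 1 unfolding green_def W_def[symmetric]
      by (simp add: ring_distribs add_divide_distrib diff_divide_distrib mult_ac)
    also have "\<dots> = wronskian V \<zeta> n / W"
      unfolding l[symmetric] wronskian_def by (simp add: ring_distribs)
    also have "\<dots> = 1" using W wronskian_const[OF rec, of n] by (simp add: W_def)
    finally show ?thesis using 1 by simp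
  next
    case (2 d)
    have m: "max n k = n" "min n k = k" "max (n + 1) k = n + 1" "min (n + 1) k = k"
      "max (n - 1) k = n - 1" "min (n - 1) k = k"
      "nat \<bar>n - k\<bar> = Suc d" "nat \<bar>n + 1 - k\<bar> = Suc (Suc d)" "nat \<bar>n - 1 - k\<bar> = d"
      using 2 by auto
    have pw: "\<zeta> ^ d = \<zeta> ^ Suc d / \<zeta>" "\<zeta> ^ Suc (Suc d) = \<zeta> ^ Suc d * \<zeta>"
      using z(1) by auto
    have "E * green V \<zeta> n k - (green V \<zeta> (n + 1) k + green V \<zeta> (n - 1) k)
       = \<zeta> ^ Suc d * ((jost V \<zeta> (n - 1) / \<zeta> + \<zeta> * jost V \<zeta> (n + 1)) - E * jost V \<zeta> n)
           * jost_left V \<zeta> k / W"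
      unfolding green_def W_def[symmetric] m pw
      by (simp add: ring_distribs add_divide_distrib diff_divide_distrib mult_ac)
    also have "\<dots> = 0" unfolding r by simp
    finally show ?thesis using 2 by simp
  next
    case (3 d)
    have m: "max n k = k" "min n k = n" "max (n + 1) k = k" "min (n + 1) k = n + 1"
      "max (n - 1) k = k" "min (n - 1) k = n - 1"
      "nat \<bar>n - k\<bar> = Suc d" "nat \<bar>n + 1 - k\<bar> = d" "nat \<bar>n - 1 - k\<bar> = Suc (Suc d)"
      using 3 by auto
    have pw: "\<zeta> ^ d = \<zeta> ^ Suc d / \<zeta>" "\<zeta> ^ Suc (Suc d) = \<zeta> ^ Suc d * \<zeta>"
      using z(1) by auto
    have "E * green V \<zeta> n k - (green V \<zeta> (n + 1) k + green V \<zeta> (n - 1) k)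
       = \<zeta> ^ Suc d * ((jost_left V \<zeta> (n + 1) / \<zeta> + \<zeta> * jost_left V \<zeta> (n - 1)) - E * jost_left V \<zeta> n)
           * jost V \<zeta> k / W"
      unfolding green_def W_def[symmetric] m pw
      by (simp add: ring_distribs add_divide_distrib diff_divide_distrib mult_ac)
    also have "\<dots> = 0" unfolding l by simp
    finally show ?thesis using 3 by simp
  qed
  then show ?thesis by (simp add: E_def)
qed

definition green_op :: "(int \<Rightarrow> real) \<Rightarrow> complex \<Rightarrow> (int \<Rightarrow> complex) \<Rightarrow> int \<Rightarrow> complex" where
  "green_op V \<zeta> u n = (\<Sum>\<^sub>\<infinity>k. green V \<zeta> n k * u k)"

text \<open>Compactness and continuity turn the non-vanishing of the Wronskian into a uniform bound
  for its inverse. The power of \<open>cmod \<zeta>\<close> is retained because it supplies the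
  decay inside the disc.\<close>

lemma green_bounded_continuous:
  assumes S: "compact S" "\<And>\<zeta>. \<zeta> \<in> S \<Longrightarrow> cmod \<zeta> \<le> 1 \<and> Im \<zeta> \<noteq> 0" and V: "V summable_on UNIV"
  shows "\<exists>B. \<forall>\<zeta>\<in>S. \<forall>n k. cmod (green V \<zeta> n k) \<le> B * cmod \<zeta> ^ nat \<bar>n - k\<bar>"
    and "continuous_on S (\<lambda>\<zeta>. green V \<zeta> n k)"
proof -
  have c: "continuous_on S jost_coeff"
    unfolding jost_coeff_def by (intro continuous_intros) (use S Im_neq_0_imp in auto)
  have "bounded (jost_coeff ` S)"
    by (intro compact_imp_bounded compact_continuous_image c S)
  then obtain C where C: "\<And>\<zeta>. \<zeta> \<in> S \<Longrightarrow> cmod (jost_coeff \<zeta>) \<le> C"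
    by (auto simp: bounded_iff)
  have r: "continuous_on S (\<lambda>\<zeta>. jost V \<zeta> n)" for n
    by (rule continuous_on_jost[of S C]) (use S C V Im_neq_0_imp in auto)
  have l: "continuous_on S (\<lambda>\<zeta>. jost_left V \<zeta> n)" for n
    unfolding jost_left_def
    by (rule continuous_on_jost[of S C]) (use S C Im_neq_0_imp summable_reflect[OF V] in auto)
  have nz: "wronskian V \<zeta> 0 \<noteq> 0" "\<zeta> \<noteq> 0" if "\<zeta> \<in> S" for \<zeta>
    using wronskian_nonzero[of \<zeta> V] S V that Im_neq_0_imp by auto
  have w: "continuous_on S (\<lambda>\<zeta>. wronskian V \<zeta> 0)"
    unfolding wronskian_def by (intro continuous_intros r l) (use nz in auto)
  show "continuous_on S (\<lambda>\<zeta>. green V \<zeta> n k)"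
    unfolding green_def by (intro continuous_intros r l w) (use nz in auto)
  have "bounded ((\<lambda>\<zeta>. inverse (wronskian V \<zeta> 0)) ` S)"
    by (intro compact_imp_bounded compact_continuous_image continuous_intros w S) (use nz in auto)
  then obtain D where D: "\<And>\<zeta>. \<zeta> \<in> S \<Longrightarrow> cmod (inverse (wronskian V \<zeta> 0)) \<le> D"
    by (auto simp: bounded_iff)
  define M where "M = 1 + 2 * jost_bound V C * (\<Sum>\<^sub>\<infinity>n. \<bar>V n\<bar>)"
  have "cmod (green V \<zeta> n k) \<le> (M * M * D) * cmod \<zeta> ^ nat \<bar>n - k\<bar>" if "\<zeta> \<in> S" for \<zeta> n k
  proof -
    have r: "cmod (jost V \<zeta> m) \<le> M" for m
      unfolding M_def by (rule norm_jost_le) (use that S C V in auto)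
    have l: "cmod (jost_left V \<zeta> m) \<le> M" for m
      unfolding M_def by (rule norm_jost_left_le) (use that S C V in auto)
    have M0: "0 \<le> M" using r[of 0] norm_ge_zero order_trans by blast
    have D0: "0 \<le> D" using D[OF that] norm_ge_zero order_trans by blast
    have "cmod (green V \<zeta> n k) = (cmod (jost V \<zeta> (max n k)) * cmod (jost_left V \<zeta> (min n k))
        * cmod (inverse (wronskian V \<zeta> 0))) * cmod \<zeta> ^ nat \<bar>n - k\<bar>"
      by (simp add: green_def norm_mult norm_divide norm_power norm_inverse divide_inverse mult_ac)
    also have "\<dots> \<le> (M * M * D) * cmod \<zeta> ^ nat \<bar>n - k\<bar>"
      by (intro mult_right_mono mult_mono r l D that) (use M0 D0 in auto)
    finally show ?thesis .
  qed
  then show "\<exists>B. \<forall>\<zeta>\<in>S. \<forall>n k. cmod (green V \<zeta> n k) \<le> B * cmod \<zeta> ^ nat \<bar>n - k\<bar>"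
    by blast
qed

lemma summable_on_int_halvesI:
  fixes f :: "int \<Rightarrow> real"
  assumes "summable (\<lambda>i. f (int i))" "summable (\<lambda>i. f (- int i))" "\<And>n. 0 \<le> f n"
  shows "f summable_on UNIV"
proof -
  have "f summable_on range int"
    by (subst summable_on_reindex) (use assms in \<open>auto simp: summable_on_UNIV_nonneg_real_iff o_def\<close>)
  moreover have "f summable_on range (\<lambda>i. - int i)"
    by (subst summable_on_reindex) (use assms in \<open>auto simp: summable_on_UNIV_nonneg_real_iff o_def inj_def\<close>)
  ultimately have "f summable_on (range int \<union> range (\<lambda>i. - int i))"
    by (rule summable_on_union)
  moreover have "range int \<union> range (\<lambda>i. - int i) = UNIV"
    by (auto simp: image_iff) (metis int_cases2)
  ultimately show ?thesis by simp
qed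

lemma geometric_int_summable:
  assumes "0 \<le> r" "r < (1 :: real)"
  shows "(\<lambda>n::int. r ^ nat \<bar>n\<bar>) summable_on UNIV"
  by (rule summable_on_int_halvesI) (use assms in \<open>auto intro: summable_geometric\<close>)

lemma summable_mult_bounded:
  fixes u :: "'a \<Rightarrow> complex"
  assumes "(\<lambda>k. cmod (u k)) summable_on A" "\<And>k. cmod (a k) \<le> B"
  shows "(\<lambda>k. cmod (a k * u k)) summable_on A" "(\<lambda>k. a k * u k) summable_on A"
proof -
  show "(\<lambda>k. cmod (a k * u k)) summable_on A"
    by (rule Infinite_Sum.abs_summable_on_comparison_test'[OF summable_on_cmult_right[OF assms(1), of B]])
      (use assms(2) in \<open>auto simp: norm_mult intro: mult_right_mono\<close>)
  then show "(\<lambda>k. a k * u k) summable_on A"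
    by (rule abs_summable_summable)
qed

text \<open>\<open>green_equation\<close> is summed against \<open>u\<close>; the kernel is bounded
  and \<open>u\<close> summable, so all series converge, on the unit circle too.\<close>

lemma green_op_solves:
  assumes z: "cmod \<zeta> \<le> 1" "Im \<zeta> \<noteq> 0" and V: "V summable_on UNIV"
    and u: "(\<lambda>k. cmod (u k)) summable_on UNIV"
  shows "schroedinger V (green_op V \<zeta> u) n - (2 - \<zeta> - 1 / \<zeta>) * green_op V \<zeta> u n = u n"
proof -
  obtain B where B: "\<And>n k. cmod (green V \<zeta> n k) \<le> B * cmod \<zeta> ^ nat \<bar>n - k\<bar>"
    using green_bounded_continuous(1)[of "{\<zeta>}" V] z V by auto
  have B0: "0 \<le> B" using order_trans[OF norm_ge_zero B[of 0 0]] by simp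
  have bd: "cmod (green V \<zeta> n k) \<le> B" for n k
    by (rule order_trans[OF B mult_left_le[OF power_le_one[OF norm_ge_zero z(1)] B0]])
  have G: "((\<lambda>k. green V \<zeta> m k * u k) has_sum green_op V \<zeta> u m) UNIV" for m
    unfolding green_op_def by (intro has_sum_infsum summable_mult_bounded(2)[OF u bd])
  let ?E = "\<zeta> + 1 / \<zeta> + V n"
  have "((\<lambda>k. ?E * (green V \<zeta> n k * u k)
        + (- 1) * (green V \<zeta> (n + 1) k * u k + green V \<zeta> (n - 1) k * u k))
      has_sum ?E * green_op V \<zeta> u n + (- 1) * (green_op V \<zeta> u (n + 1) + green_op V \<zeta> u (n - 1))) UNIV"
    by (intro has_sum_add has_sum_cmult_right G)
  moreover have "?E * (green V \<zeta> n k * u k)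
        + (- 1) * (green V \<zeta> (n + 1) k * u k + green V \<zeta> (n - 1) k * u k)
      = (if n = k then 1 else 0) * u k" for k
    unfolding green_equation[OF z(1) V z(2), of n k, symmetric] by (simp add: algebra_simps)
  ultimately have "((\<lambda>k. (if n = k then 1 else 0) * u k)
      has_sum ?E * green_op V \<zeta> u n + (- 1) * (green_op V \<zeta> u (n + 1) + green_op V \<zeta> u (n - 1))) UNIV"
    by simp
  moreover have "((\<lambda>k. (if n = k then 1 else 0) * u k) has_sum u n) UNIV"
    by (rule has_sum_finite_neutralI[of "{n}"]) auto
  ultimately have "?E * green_op V \<zeta> u n + (- 1) * (green_op V \<zeta> u (n + 1) + green_op V \<zeta> u (n - 1)) = u n"
    by (rule has_sum_unique)
  then show ?thesis by (simp add: schroedinger_def algebra_simps)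
qed

text \<open>Inside the disc the kernel is dominated by a geometric convolution kernel, which maps
  summable sequences to summable ones, and these are square-summable.\<close>

lemma green_op_in_l2:
  assumes z: "cmod \<zeta> < 1" "Im \<zeta> \<noteq> 0" and V: "V summable_on UNIV"
    and u: "(\<lambda>k. cmod (u k)) summable_on UNIV"
  shows "green_op V \<zeta> u \<in> weighted_l2 0"
proof -
  obtain B where B: "\<And>n k. cmod (green V \<zeta> n k) \<le> B * cmod \<zeta> ^ nat \<bar>n - k\<bar>"
    using green_bounded_continuous(1)[of "{\<zeta>}" V] z V by auto
  have B0: "0 \<le> B" using order_trans[OF norm_ge_zero B[of 0 0]] by simp
  have bd: "cmod (green V \<zeta> n k) \<le> B" for n k
    by (rule order_trans[OF B mult_left_le[OF power_le_one[OF norm_ge_zero less_imp_le[OF z(1)]] B0]])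
  note abs = summable_mult_bounded(1)[OF u bd]
  \<comment> \<open>With \<open>k\<close> first, the inner sums over \<open>n\<close> are geometric;
    afterwards the double series is reordered to reach the row sums.\<close>
  define F where "F = (\<lambda>(k, n). B * cmod \<zeta> ^ nat \<bar>n - k\<bar> * cmod (u k))"
  define A where "A = (\<Sum>\<^sub>\<infinity>n::int. cmod \<zeta> ^ nat \<bar>n\<bar>)"
  have geo: "((\<lambda>n. cmod \<zeta> ^ nat \<bar>n - k\<bar>) has_sum A) UNIV" for k :: int
  proof -
    have "bij_betw (\<lambda>n. n - k) UNIV UNIV"
      by (rule bij_betwI[where g = "\<lambda>n. n + k"]) auto
    from has_sum_reindex_bij_betw[OF this, of "\<lambda>n. cmod \<zeta> ^ nat \<bar>n\<bar>" A] show ?thesis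
      unfolding A_def using geometric_int_summable[of "cmod \<zeta>"] z(1) by simp
  qed
  have "F summable_on (UNIV \<times> UNIV)"
  proof (rule summable_on_SigmaI)
    show "((\<lambda>n. F (k, n)) has_sum (B * A * cmod (u k))) UNIV" for k
      unfolding F_def by (auto intro!: has_sum_cmult_left has_sum_cmult_right geo)
    show "(\<lambda>k. B * A * cmod (u k)) summable_on UNIV"
      by (intro summable_on_cmult_right u)
  qed (use B0 in \<open>auto simp: F_def\<close>)
  then have F: "(\<lambda>(n, k). F (k, n)) summable_on (UNIV \<times> UNIV)"
    by (subst summable_on_swap) simp
  have sum_F: "(\<lambda>k. F (k, n)) summable_on UNIV" for n
    using summable_on_SigmaD1[OF F, of n] by simp
  have "(\<lambda>n. \<Sum>\<^sub>\<infinity>k. F (k, n)) summable_on UNIV"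
    using summable_on_SigmaD[OF F] sum_F by simp
  then have sv: "(\<lambda>n. cmod (green_op V \<zeta> u n)) summable_on UNIV"
  proof (rule Infinite_Sum.abs_summable_on_comparison_test')
    fix n
    have "cmod (green_op V \<zeta> u n) \<le> (\<Sum>\<^sub>\<infinity>k. cmod (green V \<zeta> n k * u k))"
      unfolding green_op_def by (rule norm_infsum_bound[OF abs])
    also have "\<dots> \<le> (\<Sum>\<^sub>\<infinity>k. F (k, n))"
      by (rule infsum_mono[OF abs sum_F]) (use B in \<open>auto simp: F_def norm_mult intro: mult_right_mono\<close>)
    finally show "cmod (green_op V \<zeta> u n) \<le> (\<Sum>\<^sub>\<infinity>k. F (k, n))" .
  qed
  \<comment> \<open>A summable sequence is bounded by its sum, so its square is at most a constant
    times itself.\<close>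
  have le: "cmod (green_op V \<zeta> u n) \<le> (\<Sum>\<^sub>\<infinity>n. cmod (green_op V \<zeta> u n))" for n
    using finite_sum_le_infsum[OF sv, of "{n}"] by simp
  have "(\<lambda>n. cmod (complex_of_real (cmod (green_op V \<zeta> u n)) * green_op V \<zeta> u n)) summable_on UNIV"
    by (rule summable_mult_bounded(1)[OF sv]) (use le in simp)
  then show ?thesis
    unfolding weighted_l2_0_iff by (simp add: norm_mult power2_eq_square)
qed

section \<open>Injectivity and identification of the resolvent\<close>

lemma weighted_l2_add:
  assumes "u \<in> weighted_l2 \<sigma>" "v \<in> weighted_l2 \<sigma>"
  shows "(\<lambda>n. u n + v n) \<in> weighted_l2 \<sigma>"
proof -
  let ?w = "\<lambda>n. (1 + (real_of_int n)\<^sup>2) powr \<sigma>"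
  have s: "(\<lambda>n. 2 * (?w n * (cmod (u n))\<^sup>2) + 2 * (?w n * (cmod (v n))\<^sup>2)) summable_on UNIV"
    using assms unfolding weighted_l2_def by (intro summable_on_add summable_on_cmult_right) auto
  have "?w n * (cmod (u n + v n))\<^sup>2 \<le> 2 * (?w n * (cmod (u n))\<^sup>2) + 2 * (?w n * (cmod (v n))\<^sup>2)" for n
  proof -
    have "(cmod (u n + v n))\<^sup>2 \<le> (cmod (u n) + cmod (v n))\<^sup>2"
      by (intro power_mono norm_triangle_ineq) auto
    also have "\<dots> \<le> 2 * (cmod (u n))\<^sup>2 + 2 * (cmod (v n))\<^sup>2"
      using sum_squares_bound[of "cmod (u n)" "cmod (v n)"] by (simp add: power2_sum)
    finally have "?w n * (cmod (u n + v n))\<^sup>2 \<le> ?w n * (2 * (cmod (u n))\<^sup>2 + 2 * (cmod (v n))\<^sup>2)"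
      by (intro mult_left_mono) auto
    then show ?thesis by (simp add: algebra_simps)
  qed
  from summable_on_comparison_test[OF s this] show ?thesis by (simp add: weighted_l2_def)
qed

lemma weighted_l2_cmult:
  assumes "u \<in> weighted_l2 \<sigma>"
  shows "(\<lambda>n. c * u n) \<in> weighted_l2 \<sigma>"
proof -
  have "(\<lambda>n. (cmod c)\<^sup>2 * ((1 + (real_of_int n)\<^sup>2) powr \<sigma> * (cmod (u n))\<^sup>2)) summable_on UNIV"
    using assms by (intro summable_on_cmult_right) (simp add: weighted_l2_def)
  then show ?thesis by (simp add: weighted_l2_def norm_mult power_mult_distrib mult_ac)
qed

lemma weighted_l2_diff:
  assumes "u \<in> weighted_l2 \<sigma>" "v \<in> weighted_l2 \<sigma>"
  shows "(\<lambda>n. u n - v n) \<in> weighted_l2 \<sigma>"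
  using weighted_l2_add[OF assms(1) weighted_l2_cmult[OF assms(2), of "- 1"]] by simp

lemma inj_on_schroedinger:
  assumes "Im z \<noteq> 0"
  shows "inj_on (\<lambda>u n. schroedinger V u n - z * u n) (weighted_l2 0)"
proof (rule inj_onI)
  fix u v :: "int \<Rightarrow> complex"
  assume uv: "u \<in> weighted_l2 0" "v \<in> weighted_l2 0"
    and eq: "(\<lambda>n. schroedinger V u n - z * u n) = (\<lambda>n. schroedinger V v n - z * v n)"
  have "u n - v n = 0" for n
  proof (rule l2_solution_eq_0[OF weighted_l2_diff[OF uv] assms])
    show "(u (n + 1) - v (n + 1)) + (u (n - 1) - v (n - 1))
        = (2 + complex_of_real (V n) - z) * (u n - v n)" for n
      using fun_cong[OF eq, of n] by (simp add: schroedinger_def algebra_simps)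
  qed
  then show "u = v" by auto
qed

text \<open>As an \<open>inv_into\<close>, \<open>resolvent\<close> is determined at
  \<open>u\<close> by injectivity on l2 and one square-summable preimage of \<open>u\<close>, which
  the Green operator provides.\<close>

lemma resolvent_eq_green_op:
  assumes "cmod \<zeta> < 1" "Im \<zeta> \<noteq> 0" "V summable_on UNIV" "(\<lambda>k. cmod (u k)) summable_on UNIV"
  shows "resolvent V (2 - \<zeta> - 1 / \<zeta>) u = green_op V \<zeta> u"
  unfolding resolvent_def
proof (rule inv_into_f_eq)
  have "(cmod \<zeta>)\<^sup>2 < 1" "(cmod \<zeta>)\<^sup>2 > 0"
    using assms(1) Im_neq_0_imp(1)[OF assms(2)] by (auto simp: power_less_one_iff)
  then have "1 / (cmod \<zeta>)\<^sup>2 - 1 \<noteq> 0" by (simp add: field_simps)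
  then have "Im (2 - \<zeta> - 1 / \<zeta>) \<noteq> 0"
    unfolding Im_spectral_parameter[OF assms(2)] using assms(2) by (simp only: mult_eq_0_iff) simp
  then show "inj_on (\<lambda>u n. schroedinger V u n - (2 - \<zeta> - 1 / \<zeta>) * u n) (weighted_l2 0)"
    by (rule inj_on_schroedinger)
  show "green_op V \<zeta> u \<in> weighted_l2 0"
    by (rule green_op_in_l2[OF assms])
  show "(\<lambda>n. schroedinger V (green_op V \<zeta> u) n - (2 - \<zeta> - 1 / \<zeta>) * green_op V \<zeta> u n) = u"
    by (rule ext, rule green_op_solves) (use assms in auto)
qed

section \<open>Hilbert--Schmidt bounds\<close>

lemma weight_pos: "0 < 1 + (real_of_int n)\<^sup>2"
  by (simp add: add_pos_nonneg)

lemma weight_summable: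
  assumes "\<sigma> > 1 / 2"
  shows "(\<lambda>n. (1 + (real_of_int n)\<^sup>2) powr (- \<sigma>)) summable_on UNIV"
proof (rule summable_on_int_halvesI)
  have *: "summable (\<lambda>i. (1 + (real i)\<^sup>2) powr (- \<sigma>))"
  proof (rule summable_comparison_test')
    show "summable (\<lambda>i. real i powr (- 2 * \<sigma>))"
      using assms by (simp add: summable_real_powr_iff)
    \<comment> \<open>Index 0 is left out: there the majorant is \<open>0\<close> by the convention
      for \<open>powr\<close>, while the weight is 1.\<close>
    show "norm ((1 + (real i)\<^sup>2) powr (- \<sigma>)) \<le> real i powr (- 2 * \<sigma>)" if "1 \<le> i" for i
    proof -
      have "(1 + (real i)\<^sup>2) powr (- \<sigma>) \<le> ((real i)\<^sup>2) powr (- \<sigma>)"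
        using that assms by (intro powr_mono2') auto
      also have "\<dots> = real i powr (- 2 * \<sigma>)"
        using that by (simp add: powr_powr flip: powr_numeral)
      finally show ?thesis by simp
    qed
  qed
  then show "summable (\<lambda>i. (1 + (real_of_int (int i))\<^sup>2) powr (- \<sigma>))"
    "summable (\<lambda>i. (1 + (real_of_int (- int i))\<^sup>2) powr (- \<sigma>))" by simp_all
qed simp

lemma Cauchy_Schwarz_summable:
  fixes f g :: "'a \<Rightarrow> real"
  assumes "(\<lambda>k. (f k)\<^sup>2) summable_on A" "(\<lambda>k. (g k)\<^sup>2) summable_on A"
    and "\<And>k. 0 \<le> f k" "\<And>k. 0 \<le> g k"
  shows "(\<lambda>k. f k * g k) summable_on A"
    and "(\<Sum>\<^sub>\<infinity>k\<in>A. f k * g k)\<^sup>2 \<le> (\<Sum>\<^sub>\<infinity>k\<in>A. (f k)\<^sup>2) * (\<Sum>\<^sub>\<infinity>k\<in>A. (g k)\<^sup>2)"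
proof -
  show s: "(\<lambda>k. f k * g k) summable_on A"
  proof (rule summable_on_comparison_test[OF summable_on_add[OF assms(1,2)]])
    show "f k * g k \<le> (f k)\<^sup>2 + (g k)\<^sup>2" for k
      using sum_squares_bound[of "f k" "g k"] mult_nonneg_nonneg[OF assms(3,4), of k k] by simp
  qed (use assms in auto)
  let ?P = "(\<Sum>\<^sub>\<infinity>k\<in>A. (f k)\<^sup>2) * (\<Sum>\<^sub>\<infinity>k\<in>A. (g k)\<^sup>2)"
  have "(\<Sum>\<^sub>\<infinity>k\<in>A. f k * g k) \<le> sqrt ?P"
  proof (rule infsum_le_finite_sums[OF s])
    fix F assume F: "finite F" "F \<subseteq> A"
    have "(\<Sum>k\<in>F. f k * g k)\<^sup>2 \<le> (\<Sum>k\<in>F. (f k)\<^sup>2) * (\<Sum>k\<in>F. (g k)\<^sup>2)"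
      by (rule Cauchy_Schwarz_ineq_sum)
    also have "\<dots> \<le> ?P"
      by (intro mult_mono finite_sum_le_infsum assms F sum_nonneg infsum_nonneg) auto
    finally show "(\<Sum>k\<in>F. f k * g k) \<le> sqrt ?P"
      by (rule real_le_rsqrt)
  qed
  moreover have "0 \<le> (\<Sum>\<^sub>\<infinity>k\<in>A. f k * g k)"
    by (intro infsum_nonneg mult_nonneg_nonneg assms)
  ultimately have "(\<Sum>\<^sub>\<infinity>k\<in>A. f k * g k)\<^sup>2 \<le> (sqrt ?P)\<^sup>2"
    by (intro power_mono)
  also have "\<dots> = ?P"
    by (intro real_sqrt_pow2 mult_nonneg_nonneg infsum_nonneg) auto
  finally show "(\<Sum>\<^sub>\<infinity>k\<in>A. f k * g k)\<^sup>2 \<le> ?P" .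
qed

text \<open>The squared Hilbert--Schmidt norm of a kernel, from weight exponent \<open>\<sigma>\<close> to \<open>- \<sigma>\<close>.\<close>

definition hs_sq :: "real \<Rightarrow> (int \<Rightarrow> int \<Rightarrow> complex) \<Rightarrow> real" where
  "hs_sq \<sigma> K = (\<Sum>\<^sub>\<infinity>(n, k). (1 + (real_of_int n)\<^sup>2) powr (- \<sigma>) * (1 + (real_of_int k)\<^sup>2) powr (- \<sigma>)
      * (cmod (K n k))\<^sup>2)"

lemma weight_product_summable:
  assumes "\<sigma> > 1 / 2"
  shows "(\<lambda>(n, k). (1 + (real_of_int n)\<^sup>2) powr (- \<sigma>) * (1 + (real_of_int k)\<^sup>2) powr (- \<sigma>) * D)
    summable_on UNIV"
proof -
  have "(\<lambda>(n, k). (1 + (real_of_int n)\<^sup>2) powr (- \<sigma>) * (1 + (real_of_int k)\<^sup>2) powr (- \<sigma>))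
      summable_on UNIV \<times> UNIV"
    using weight_summable[OF assms]
    by (intro summable_on_SigmaI[where g = "\<lambda>n. (1 + (real_of_int n)\<^sup>2) powr (- \<sigma>)
          * (\<Sum>\<^sub>\<infinity>k. (1 + (real_of_int k)\<^sup>2) powr (- \<sigma>))"])
      (auto intro!: has_sum_cmult_right summable_on_cmult_left)
  from summable_on_cmult_left[OF this, of D] show ?thesis
    by (simp add: case_prod_unfold)
qed

lemma hs_summable:
  assumes "\<sigma> > 1 / 2" "\<And>n k. cmod (K n k) \<le> B"
  shows "(\<lambda>(n, k). (1 + (real_of_int n)\<^sup>2) powr (- \<sigma>) * (1 + (real_of_int k)\<^sup>2) powr (- \<sigma>)
      * (cmod (K n k))\<^sup>2) summable_on UNIV"
  by (rule summable_on_comparison_test[OF weight_product_summable[OF assms(1), of "B\<^sup>2"]])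
    (use assms(2) in \<open>auto intro!: mult_left_mono power_mono\<close>)

text \<open>Cauchy-Schwarz after splitting off the weight to the power
  \<open>- \<sigma> / 2\<close>, which is square-summable for
  \<open>\<sigma> > 1 / 2\<close>.\<close>

lemma weighted_l2_imp_summable:
  assumes "\<sigma> > 1 / 2" "u \<in> weighted_l2 \<sigma>"
  shows "(\<lambda>k. cmod (u k)) summable_on UNIV"
proof -
  let ?w = "\<lambda>k. 1 + (real_of_int k)\<^sup>2"
  have "(\<lambda>k. ?w k powr (- \<sigma> / 2) * (?w k powr (\<sigma> / 2) * cmod (u k))) summable_on UNIV"
    using weight_summable[OF assms(1)] assms(2)
    by (intro Cauchy_Schwarz_summable(1))
      (auto simp: weighted_l2_def power_mult_distrib power2_eq_square[of "_ powr _"] powr_add[symmetric])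
  then show ?thesis
    using weight_pos by (simp add: powr_add[symmetric] mult.assoc[symmetric] less_imp_neq[THEN not_sym])
qed

text \<open>Cauchy-Schwarz along row \<open>n\<close> bounds the squared value there by
  \<open>h n * U\<close>, with \<open>h n\<close> the weighted squared norm of the row and
  \<open>U\<close> that of \<open>u\<close>. The weighted sum of the \<open>h n\<close> is
  \<open>hs_sq \<sigma> K\<close> by Fubini.\<close>

lemma hs_bound:
  assumes \<sigma>: "\<sigma> > 1 / 2" and K: "\<And>n k. cmod (K n k) \<le> B" and u: "u \<in> weighted_l2 \<sigma>"
  shows "(\<lambda>n. \<Sum>\<^sub>\<infinity>k. K n k * u k) \<in> weighted_l2 (- \<sigma>)"
    and "weighted_l2_norm (- \<sigma>) (\<lambda>n. \<Sum>\<^sub>\<infinity>k. K n k * u k) \<le> sqrt (hs_sq \<sigma> K) * weighted_l2_norm \<sigma> u"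
proof -
  let ?w = "\<lambda>k. 1 + (real_of_int k)\<^sup>2"
  let ?g = "\<lambda>k. ?w k powr (\<sigma> / 2) * cmod (u k)"
  define U where "U = (\<Sum>\<^sub>\<infinity>k. ?w k powr \<sigma> * (cmod (u k))\<^sup>2)"
  define h where "h n = (\<Sum>\<^sub>\<infinity>k. ?w k powr (- \<sigma>) * (cmod (K n k))\<^sup>2)" for n
  note abs = summable_mult_bounded(1)[OF weighted_l2_imp_summable[OF \<sigma> u] K]
  have g2: "(?g k)\<^sup>2 = ?w k powr \<sigma> * (cmod (u k))\<^sup>2" for k
    by (simp add: power_mult_distrib power2_eq_square[of "_ powr _"] powr_add[symmetric])
  have f2: "(?w k powr (- \<sigma> / 2) * cmod (K n k))\<^sup>2 = ?w k powr (- \<sigma>) * (cmod (K n k))\<^sup>2" for n k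
    by (simp add: power_mult_distrib power2_eq_square[of "_ powr _"] powr_add[symmetric])
  have fg: "?w k powr (- \<sigma> / 2) * cmod (K n k) * ?g k = cmod (K n k * u k)" for n k
  proof -
    have "?w k powr (- \<sigma> / 2) * ?w k powr (\<sigma> / 2) = 1"
      using weight_pos[of k] by (simp add: powr_add[symmetric])
    then show ?thesis
      by (metis (no_types, lifting) mult.assoc mult.commute mult_1 norm_mult)
  qed
  have sh: "(\<lambda>k. ?w k powr (- \<sigma>) * (cmod (K n k))\<^sup>2) summable_on UNIV" for n
    by (rule summable_on_comparison_test[OF summable_on_cmult_left[OF weight_summable[OF \<sigma>], of "B\<^sup>2"]])
      (use K in \<open>auto intro!: mult_left_mono power_mono\<close>)
  have sg: "(\<lambda>k. ?w k powr \<sigma> * (cmod (u k))\<^sup>2) summable_on UNIV"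
    using u by (simp add: weighted_l2_def)
  have row: "(cmod (\<Sum>\<^sub>\<infinity>k. K n k * u k))\<^sup>2 \<le> h n * U" for n
  proof -
    have "(cmod (\<Sum>\<^sub>\<infinity>k. K n k * u k))\<^sup>2 \<le> (\<Sum>\<^sub>\<infinity>k. cmod (K n k * u k))\<^sup>2"
      by (intro power_mono norm_infsum_bound abs) auto
    also have "\<dots> \<le> h n * U"
      using Cauchy_Schwarz_summable(2)[of "\<lambda>k. ?w k powr (- \<sigma> / 2) * cmod (K n k)" UNIV ?g] sh[of n] sg
      unfolding f2 g2 fg h_def U_def by simp
    finally show ?thesis .
  qed
  have hs: "(\<lambda>(n, k). ?w n powr (- \<sigma>) * ?w k powr (- \<sigma>) * (cmod (K n k))\<^sup>2) summable_on UNIV \<times> UNIV"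
    using hs_summable[OF \<sigma> K] by simp
  have inner: "(\<Sum>\<^sub>\<infinity>k. ?w n powr (- \<sigma>) * ?w k powr (- \<sigma>) * (cmod (K n k))\<^sup>2) = ?w n powr (- \<sigma>) * h n" for n
    unfolding h_def mult.assoc by (rule infsum_cmult_right')
  have swh: "(\<lambda>n. ?w n powr (- \<sigma>) * h n) summable_on UNIV"
    using summable_on_Sigma_banach[OF hs] by (simp add: inner)
  have hs_eq: "hs_sq \<sigma> K = (\<Sum>\<^sub>\<infinity>n. ?w n powr (- \<sigma>) * h n)"
    using infsum_Sigma'_banach[OF hs] by (simp add: inner hs_sq_def)
  have U0: "0 \<le> U" unfolding U_def by (intro infsum_nonneg) auto
  have le: "?w n powr (- \<sigma>) * (cmod (\<Sum>\<^sub>\<infinity>k. K n k * u k))\<^sup>2 \<le> ?w n powr (- \<sigma>) * h n * U" for n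
    unfolding mult.assoc by (intro mult_left_mono row) auto
  have s: "(\<lambda>n. ?w n powr (- \<sigma>) * (cmod (\<Sum>\<^sub>\<infinity>k. K n k * u k))\<^sup>2) summable_on UNIV"
    by (rule summable_on_comparison_test[OF summable_on_cmult_left[OF swh, of U]]) (use le in auto)
  then show "(\<lambda>n. \<Sum>\<^sub>\<infinity>k. K n k * u k) \<in> weighted_l2 (- \<sigma>)"
    by (simp add: weighted_l2_def)
  have "(\<Sum>\<^sub>\<infinity>n. ?w n powr (- \<sigma>) * (cmod (\<Sum>\<^sub>\<infinity>k. K n k * u k))\<^sup>2) \<le> (\<Sum>\<^sub>\<infinity>n. ?w n powr (- \<sigma>) * h n * U)"
    by (rule infsum_mono[OF s summable_on_cmult_left[OF swh] le])
  also have "\<dots> = hs_sq \<sigma> K * U"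
    unfolding hs_eq by (rule infsum_cmult_left')
  finally show "weighted_l2_norm (- \<sigma>) (\<lambda>n. \<Sum>\<^sub>\<infinity>k. K n k * u k) \<le> sqrt (hs_sq \<sigma> K) * weighted_l2_norm \<sigma> u"
    unfolding weighted_l2_norm_def U_def real_sqrt_mult[symmetric] by (rule real_sqrt_le_mono)
qed

lemma hs_sq_le:
  assumes "\<sigma> > 1 / 2" "\<And>n k. cmod (K n k) \<le> B"
  shows "hs_sq \<sigma> K \<le> (\<Sum>\<^sub>\<infinity>(n, k). (1 + (real_of_int n)\<^sup>2) powr (- \<sigma>) * (1 + (real_of_int k)\<^sup>2) powr (- \<sigma>) * B\<^sup>2)"
  unfolding hs_sq_def
  by (rule infsum_mono[OF hs_summable weight_product_summable])
    (use assms in \<open>auto intro!: mult_left_mono power_mono\<close>)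

text \<open>The product of the weights times \<open>B\<^sup>2\<close> is a summable majorant
  independent of \<open>x\<close>, so the M-test over pairs of indices plays the part of dominated
  convergence.\<close>

lemma continuous_on_hs_sq:
  fixes K :: "'p::topological_space \<Rightarrow> int \<Rightarrow> int \<Rightarrow> complex"
  assumes \<sigma>: "\<sigma> > 1 / 2" and B: "\<And>x n k. x \<in> S \<Longrightarrow> cmod (K x n k) \<le> B"
    and c: "\<And>n k. continuous_on S (\<lambda>x. K x n k)"
  shows "continuous_on S (\<lambda>x. hs_sq \<sigma> (K x))"
proof -
  let ?w = "\<lambda>n. (1 + (real_of_int n)\<^sup>2) powr (- \<sigma>)"
  let ?f = "\<lambda>p x. ?w (fst p) * ?w (snd p) * (cmod (K x (fst p) (snd p)))\<^sup>2"
  have "uniform_limit S (\<lambda>F x. \<Sum>p\<in>F. ?f p x) (\<lambda>x. \<Sum>\<^sub>\<infinity>p. ?f p x) (finite_subsets_at_top UNIV)"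
  proof (rule Weierstrass_m_test_general)
    show "(\<lambda>p. ?w (fst p) * ?w (snd p) * B\<^sup>2) summable_on UNIV"
      using weight_product_summable[OF \<sigma>, of "B\<^sup>2"] by (simp add: case_prod_unfold)
    show "norm (?f p x) \<le> ?w (fst p) * ?w (snd p) * B\<^sup>2" if "x \<in> S" for p x
      using B[OF that] by (auto intro!: mult_left_mono power_mono simp: abs_mult)
  qed
  then have "continuous_on S (\<lambda>x. \<Sum>\<^sub>\<infinity>p. ?f p x)"
    by (rule uniform_limit_theorem[rotated])
      (auto intro!: always_eventually continuous_intros c)
  then show ?thesis by (simp add: hs_sq_def case_prod_unfold)
qed

lemma op_norm_bounds:
  assumes "\<And>u. u \<in> weighted_l2 \<sigma> \<Longrightarrow> weighted_l2_norm \<sigma>' (T u) \<le> C * weighted_l2_norm \<sigma> u" "0 \<le> C"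
  shows "0 \<le> op_norm \<sigma> \<sigma>' T" "op_norm \<sigma> \<sigma>' T \<le> C"
proof -
  let ?q = "\<lambda>u. weighted_l2_norm \<sigma>' (T u) / weighted_l2_norm \<sigma> u"
  have norm0: "0 \<le> weighted_l2_norm \<tau> v" for \<tau> v
    unfolding weighted_l2_norm_def by (intro real_sqrt_ge_zero infsum_nonneg) auto
  have q: "?q u \<le> C" if "u \<in> weighted_l2 \<sigma>" for u
    using assms(1)[OF that] assms(2) norm0[of \<sigma> u]
    by (cases "weighted_l2_norm \<sigma> u = 0") (auto simp: divide_le_eq)
  have z: "(\<lambda>_. 0) \<in> weighted_l2 \<sigma>" by (simp add: weighted_l2_def)
  show "op_norm \<sigma> \<sigma>' T \<le> C"
    unfolding op_norm_def using z q by (intro cSUP_least) auto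
  \<comment> \<open>The zero sequence gives one quotient below the supremum; the bound
    \<open>C\<close> makes the real \<open>SUP\<close> a genuine upper bound.\<close>
  have "0 \<le> ?q (\<lambda>_. 0)" using norm0 by simp
  also have "\<dots> \<le> op_norm \<sigma> \<sigma>' T"
    unfolding op_norm_def using q by (intro cSUP_upper[OF z] bdd_aboveI2) auto
  finally show "0 \<le> op_norm \<sigma> \<sigma>' T" .
qed

section \<open>The boundary values\<close>

text \<open>\<open>\<zeta>\<close> and \<open>1 / \<zeta>\<close> are the roots of a quadratic with
  sum \<open>2 - z\<close> and product 1, and discriminant \<open>- (4 * z - z\<^sup>2)\<close>. For
  \<open>0 < \<omega> < 4\<close> the number under the root has positive real part, so the principal
  branch is continuous; the sign \<open>s\<close> selects the root in the disc.\<close>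

lemma spectral_parameter:
  fixes \<omega> s :: real
  assumes "0 < \<omega>" "\<omega> < 4" "s \<in> {1, -1}"
  obtains \<zeta> :: "real \<Rightarrow> complex" where "continuous_on {0..1} \<zeta>"
    and "\<And>\<epsilon>. 0 \<le> \<epsilon> \<Longrightarrow> cmod (\<zeta> \<epsilon>) \<le> 1 \<and> Im (\<zeta> \<epsilon>) \<noteq> 0 \<and> (0 < \<epsilon> \<longrightarrow> cmod (\<zeta> \<epsilon>) < 1)
      \<and> 2 - \<zeta> \<epsilon> - 1 / \<zeta> \<epsilon> = Complex \<omega> (s * \<epsilon>)"
proof
  define z where "z \<epsilon> = Complex \<omega> (s * \<epsilon>)" for \<epsilon>
  define q where "q \<epsilon> = csqrt (4 * z \<epsilon> - (z \<epsilon>)\<^sup>2)" for \<epsilon>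
  define \<zeta> where "\<zeta> \<epsilon> = (2 - z \<epsilon> + \<i> * s * q \<epsilon>) / 2" for \<epsilon>
  define \<eta> where "\<eta> \<epsilon> = (2 - z \<epsilon> - \<i> * s * q \<epsilon>) / 2" for \<epsilon>
  have s2: "s * s = 1" using assms(3) by auto
  have z_eq: "z \<epsilon> = of_real \<omega> + \<i> * of_real (s * \<epsilon>)" for \<epsilon>
    by (simp add: z_def complex_eq_iff)
  have re: "0 < Re (4 * z \<epsilon> - (z \<epsilon>)\<^sup>2)" for \<epsilon>
  proof -
    have "Re (4 * z \<epsilon> - (z \<epsilon>)\<^sup>2) = \<omega> * (4 - \<omega>) + (s * \<epsilon>)\<^sup>2"
      by (simp add: z_def power2_eq_square algebra_simps)
    then show ?thesis using assms(1,2) by (simp add: add_pos_nonneg)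
  qed
  have cz: "continuous_on A z" for A
    unfolding z_eq by (intro continuous_intros)
  have "4 * z \<epsilon> - (z \<epsilon>)\<^sup>2 \<notin> \<real>\<^sub>\<le>\<^sub>0" for \<epsilon>
    using re[of \<epsilon>] unfolding complex_nonpos_Reals_iff by linarith
  then have "continuous_on {0..1} q"
    unfolding q_def
    by (intro continuous_on_compose2[OF continuous_on_csqrt] continuous_intros cz) auto
  then show "continuous_on {0..1} \<zeta>"
    unfolding \<zeta>_def by (intro continuous_intros cz) simp_all
  fix \<epsilon> :: real assume "0 \<le> \<epsilon>"
  have q2: "(q \<epsilon>)\<^sup>2 = 4 * z \<epsilon> - (z \<epsilon>)\<^sup>2" by (simp add: q_def)
  have "0 < Re (q \<epsilon>)"
  proof (rule ccontr)
    assume "\<not> 0 < Re (q \<epsilon>)"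
    then have "Re (q \<epsilon>) = 0" using csqrt_principal[of "4 * z \<epsilon> - (z \<epsilon>)\<^sup>2"] by (auto simp: q_def)
    then have "Re ((q \<epsilon>)\<^sup>2) \<le> 0" by (simp add: power2_eq_square)
    then show False using re[of \<epsilon>] unfolding q2 by simp
  qed
  have "\<zeta> \<epsilon> * \<eta> \<epsilon> = ((2 - z \<epsilon>)\<^sup>2 + of_real (s * s) * (q \<epsilon>)\<^sup>2) / 4"
    by (simp add: \<zeta>_def \<eta>_def power2_eq_square algebra_simps)
  also have "\<dots> = 1"
    unfolding s2 q2 by (simp add: power2_eq_square algebra_simps)
  finally have prod: "\<zeta> \<epsilon> * \<eta> \<epsilon> = 1" .
  then have nz: "\<zeta> \<epsilon> \<noteq> 0" "\<eta> \<epsilon> \<noteq> 0" by auto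
  have \<eta>_eq: "\<eta> \<epsilon> = 1 / \<zeta> \<epsilon>" using prod nz by (simp add: field_simps)
  have sum: "\<zeta> \<epsilon> + \<eta> \<epsilon> = 2 - z \<epsilon>"
    by (simp add: \<zeta>_def \<eta>_def field_simps)
  \<comment> \<open>The sign is read off at the other root \<open>\<eta>\<close>, where both
    contributions are negative or zero; for \<open>\<zeta>\<close> they have opposite signs.\<close>
  have "s * Im (\<eta> \<epsilon>) = (- (s * s) * \<epsilon> - (s * s) * Re (q \<epsilon>)) / 2"
    by (simp add: \<eta>_def z_def algebra_simps)
  then have "s * Im (\<eta> \<epsilon>) < 0"
    unfolding s2 using \<open>0 \<le> \<epsilon>\<close> \<open>0 < Re (q \<epsilon>)\<close> by simp
  moreover have conj: "Im (\<zeta> \<epsilon>) = - (Im (\<eta> \<epsilon>) * (cmod (\<zeta> \<epsilon>))\<^sup>2)"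
    unfolding \<eta>_eq using nz by (simp add: Im_divide cmod_power2 sum_power2_eq_zero_iff complex_eq_iff)
  moreover have "0 < (cmod (\<zeta> \<epsilon>))\<^sup>2" using nz by simp
  ultimately have "s * Im (\<zeta> \<epsilon>) > 0"
    by (metis minus_mult_commute mult.assoc mult_neg_pos mult_minus_right neg_0_less_iff_less)
  then have im: "Im (\<zeta> \<epsilon>) \<noteq> 0" by auto
  have *: "2 - \<zeta> \<epsilon> - 1 / \<zeta> \<epsilon> = z \<epsilon>"
    using sum unfolding \<eta>_eq by (simp add: algebra_simps)
  \<comment> \<open>Since \<open>s * Im (\<zeta> \<epsilon>)\<close> is positive, this identity with
    right side \<open>\<epsilon>\<close> places \<open>\<zeta> \<epsilon>\<close> in the closed
    disc, and in the open one for \<open>\<epsilon> > 0\<close>.\<close>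
  have "s * Im (\<zeta> \<epsilon>) * (1 / (cmod (\<zeta> \<epsilon>))\<^sup>2 - 1) = s * Im (z \<epsilon>)"
    using Im_spectral_parameter[OF im] unfolding * by simp
  then have e: "s * Im (\<zeta> \<epsilon>) * (1 / (cmod (\<zeta> \<epsilon>))\<^sup>2 - 1) = \<epsilon>"
    using s2 by (simp add: z_def mult.assoc[symmetric])
  have "0 \<le> 1 / (cmod (\<zeta> \<epsilon>))\<^sup>2 - 1"
    using \<open>0 \<le> \<epsilon>\<close> \<open>s * Im (\<zeta> \<epsilon>) > 0\<close> e by (metis zero_le_mult_iff not_less order_less_imp_le)
  then have "(cmod (\<zeta> \<epsilon>))\<^sup>2 \<le> 1\<^sup>2" using \<open>0 < (cmod (\<zeta> \<epsilon>))\<^sup>2\<close> by (simp add: field_simps)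
  then have le: "cmod (\<zeta> \<epsilon>) \<le> 1" by (rule power2_le_imp_le) simp
  have ne: "cmod (\<zeta> \<epsilon>) \<noteq> 1" if "0 < \<epsilon>" using e that by auto
  show "cmod (\<zeta> \<epsilon>) \<le> 1 \<and> Im (\<zeta> \<epsilon>) \<noteq> 0 \<and> (0 < \<epsilon> \<longrightarrow> cmod (\<zeta> \<epsilon>) < 1)
      \<and> 2 - \<zeta> \<epsilon> - 1 / \<zeta> \<epsilon> = Complex \<omega> (s * \<epsilon>)"
    by (intro conjI impI le im order_le_neq_trans[OF le] ne *[unfolded z_def])
qed

lemma weighted_l1_imp_summable:
  assumes "0 \<le> \<tau>" "(\<lambda>n. complex_of_real (V n)) \<in> weighted_l1 \<tau>"
  shows "V summable_on UNIV"
proof -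
  have "(\<lambda>n. \<bar>V n\<bar>) summable_on UNIV"
  proof (rule summable_on_comparison_test)
    show "(\<lambda>n. (1 + (real_of_int n)\<^sup>2) powr (\<tau> / 2) * \<bar>V n\<bar>) summable_on UNIV"
      using assms(2) by (simp add: weighted_l1_def)
    fix n
    have "1 \<le> (1 + (real_of_int n)\<^sup>2) powr (\<tau> / 2)"
      using assms(1) by (intro ge_one_powr_ge_zero) auto
    then show "\<bar>V n\<bar> \<le> (1 + (real_of_int n)\<^sup>2) powr (\<tau> / 2) * \<bar>V n\<bar>"
      using mult_right_mono[of 1 _ "\<bar>V n\<bar>"] by simp
  qed simp
  then show ?thesis
    using summable_on_iff_abs_summable_on_real[of V UNIV] by simp
qed

text \<open>\<open>T\<close> is prescribed on \<open>weighted_l2 \<sigma>\<close> only, because that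
  is where the resolvent is known to be a kernel operator.\<close>

lemma kernel_op_bounded_ops:
  assumes \<sigma>: "\<sigma> > 1 / 2" and K: "\<And>n k. cmod (K n k) \<le> B"
    and T: "\<And>u. u \<in> weighted_l2 \<sigma> \<Longrightarrow> T u = (\<lambda>n. \<Sum>\<^sub>\<infinity>k. K n k * u k)"
  shows "T \<in> bounded_ops \<sigma> (- \<sigma>)"
    and "0 \<le> op_norm \<sigma> (- \<sigma>) T" "op_norm \<sigma> (- \<sigma>) T \<le> sqrt (hs_sq \<sigma> K)"
proof -
  note sm = summable_mult_bounded(2)[OF weighted_l2_imp_summable[OF \<sigma>] K]
  have bd: "weighted_l2_norm (- \<sigma>) (T u) \<le> sqrt (hs_sq \<sigma> K) * weighted_l2_norm \<sigma> u"
    if "u \<in> weighted_l2 \<sigma>" for u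
    unfolding T[OF that] by (rule hs_bound(2)[OF \<sigma> K that])
  have "0 \<le> hs_sq \<sigma> K" unfolding hs_sq_def by (intro infsum_nonneg) auto
  with bd show "0 \<le> op_norm \<sigma> (- \<sigma>) T" "op_norm \<sigma> (- \<sigma>) T \<le> sqrt (hs_sq \<sigma> K)"
    by (auto intro: op_norm_bounds[of \<sigma> "- \<sigma>" T "sqrt (hs_sq \<sigma> K)"])
  show "T \<in> bounded_ops \<sigma> (- \<sigma>)"
    unfolding bounded_ops_def
  proof (intro CollectI conjI ballI allI exI)
    fix u v c assume u: "u \<in> weighted_l2 \<sigma>"
    show "T u \<in> weighted_l2 (- \<sigma>)"
      unfolding T[OF u] by (rule hs_bound(1)[OF \<sigma> K u])
    show "T (\<lambda>n. c * u n) = (\<lambda>n. c * T u n)"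
      unfolding T[OF u] T[OF weighted_l2_cmult[OF u]]
      by (simp add: mult.left_commute[of _ c] infsum_cmult_right')
    show "weighted_l2_norm (- \<sigma>) (T u) \<le> sqrt (hs_sq \<sigma> K) * weighted_l2_norm \<sigma> u"
      by (rule bd[OF u])
    assume v: "v \<in> weighted_l2 \<sigma>"
    show "T (\<lambda>n. u n + v n) = (\<lambda>n. T u n + T v n)"
      unfolding T[OF u] T[OF v] T[OF weighted_l2_add[OF u v]]
      by (simp add: distrib_left infsum_add[OF sm[OF u] sm[OF v]])
  qed
qed

theorem theorem1:
  fixes \<sigma> \<omega> s :: real and V :: "int \<Rightarrow> real"
  assumes "\<sigma> > 1 / 2"
    and "(\<lambda>n. complex_of_real (V n)) \<in> weighted_l1 (2 * \<sigma> - 1)"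
    and "0 < \<omega>" and "\<omega> < 4"
    and "s \<in> {1, -1}"
  shows "(\<forall>\<epsilon>\<in>{0<..1}. resolvent V (Complex \<omega> (s * \<epsilon>)) \<in> bounded_ops \<sigma> (-\<sigma>)) \<and>
         bdd_above ((\<lambda>\<epsilon>. op_norm \<sigma> (-\<sigma>) (resolvent V (Complex \<omega> (s * \<epsilon>)))) ` {0<..1}) \<and>
         (\<exists>R\<in>bounded_ops \<sigma> (-\<sigma>).
            ((\<lambda>\<epsilon>. op_norm \<sigma> (-\<sigma>) (\<lambda>u n. resolvent V (Complex \<omega> (s * \<epsilon>)) u n - R u n))
               \<longlongrightarrow> 0) (at_right 0))"
proof -
  note \<sigma> = assms(1)
  have V: "V summable_on UNIV"
    by (rule weighted_l1_imp_summable[OF _ assms(2)]) (use \<sigma> in simp)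
  obtain \<zeta> :: "real \<Rightarrow> complex" where c\<zeta>: "continuous_on {0..1} \<zeta>"
    and \<zeta>: "\<And>\<epsilon>. 0 \<le> \<epsilon> \<Longrightarrow> cmod (\<zeta> \<epsilon>) \<le> 1 \<and> Im (\<zeta> \<epsilon>) \<noteq> 0 \<and> (0 < \<epsilon> \<longrightarrow> cmod (\<zeta> \<epsilon>) < 1)
      \<and> 2 - \<zeta> \<epsilon> - 1 / \<zeta> \<epsilon> = Complex \<omega> (s * \<epsilon>)"
    using spectral_parameter[OF assms(3-5)] by blast
  \<comment> \<open>The closed interval includes the boundary point \<open>\<epsilon> = 0\<close>,
    so one bound \<open>B\<close> serves for all \<open>\<epsilon>\<close> and for the limit
    kernel.\<close>
  have S: "compact (\<zeta> ` {0..1})" "\<And>x. x \<in> \<zeta> ` {0..1} \<Longrightarrow> cmod x \<le> 1 \<and> Im x \<noteq> 0"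
    using \<zeta> by (auto intro!: compact_continuous_image c\<zeta>)
  define K where "K \<epsilon> n k = green V (\<zeta> \<epsilon>) n k" for \<epsilon> n k
  obtain B where B: "\<And>\<epsilon> n k. \<epsilon> \<in> {0..1} \<Longrightarrow> cmod (K \<epsilon> n k) \<le> B * cmod (\<zeta> \<epsilon>) ^ nat \<bar>n - k\<bar>"
    using green_bounded_continuous(1)[OF S V] unfolding K_def by blast
  have K: "cmod (K \<epsilon> n k) \<le> B" if "\<epsilon> \<in> {0..1}" for \<epsilon> n k
  proof -
    have "0 \<le> B" using order_trans[OF norm_ge_zero B[OF that, of 0 0]] by simp
    then show ?thesis
      using \<zeta> that by (intro order_trans[OF B[OF that] mult_left_le[OF power_le_one]]) auto
  qed
  have cK: "continuous_on {0..1} (\<lambda>\<epsilon>. K \<epsilon> n k)" for n k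
    unfolding K_def
    by (rule continuous_on_compose2[OF green_bounded_continuous(2)[OF S V] c\<zeta>]) auto
  have res: "resolvent V (Complex \<omega> (s * \<epsilon>)) u = (\<lambda>n. \<Sum>\<^sub>\<infinity>k. K \<epsilon> n k * u k)"
    if "0 < \<epsilon>" "u \<in> weighted_l2 \<sigma>" for \<epsilon> u
    using resolvent_eq_green_op[of "\<zeta> \<epsilon>" V u] \<zeta>[of \<epsilon>] V weighted_l2_imp_summable[OF \<sigma> that(2)] that(1)
    by (simp add: green_op_def K_def fun_eq_iff)
  have bounded: "resolvent V (Complex \<omega> (s * \<epsilon>)) \<in> bounded_ops \<sigma> (- \<sigma>)"
    and norm: "op_norm \<sigma> (- \<sigma>) (resolvent V (Complex \<omega> (s * \<epsilon>))) \<le> sqrt (hs_sq \<sigma> (K \<epsilon>))"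
    if "\<epsilon> \<in> {0<..1}" for \<epsilon>
    using kernel_op_bounded_ops(1,3)[OF \<sigma> K[of \<epsilon>] res[of \<epsilon>]] that by auto
  \<comment> \<open>The boundary value: the Green kernel at \<open>\<zeta> 0\<close>, which lies on
    the unit circle.\<close>
  define R where "R u n = (\<Sum>\<^sub>\<infinity>k. K 0 n k * u k)" for u n
  have R: "R \<in> bounded_ops \<sigma> (- \<sigma>)"
    by (rule kernel_op_bounded_ops(1)[OF \<sigma> K[of 0]]) (auto simp: R_def)
  have diff: "0 \<le> op_norm \<sigma> (- \<sigma>) (\<lambda>u n. resolvent V (Complex \<omega> (s * \<epsilon>)) u n - R u n)
      \<and> op_norm \<sigma> (- \<sigma>) (\<lambda>u n. resolvent V (Complex \<omega> (s * \<epsilon>)) u n - R u n)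
        \<le> sqrt (hs_sq \<sigma> (\<lambda>n k. K \<epsilon> n k - K 0 n k))"
    if "\<epsilon> \<in> {0<..1}" for \<epsilon>
  proof -
    have e: "\<epsilon> \<in> {0..1}" "0 < \<epsilon>" using that by auto
    have "(\<lambda>n. resolvent V (Complex \<omega> (s * \<epsilon>)) u n - R u n)
        = (\<lambda>n. \<Sum>\<^sub>\<infinity>k. (K \<epsilon> n k - K 0 n k) * u k)" if u: "u \<in> weighted_l2 \<sigma>" for u
    proof
      fix n
      note sm = summable_mult_bounded(2)[OF weighted_l2_imp_summable[OF \<sigma> u] K]
      have "((\<lambda>k. K \<epsilon> n k * u k + (- 1) * (K 0 n k * u k)) has_sum
          (\<Sum>\<^sub>\<infinity>k. K \<epsilon> n k * u k) + (- 1) * R u n) UNIV"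
        unfolding R_def using e(1) by (intro has_sum_add has_sum_cmult_right has_sum_infsum sm) auto
      then have "((\<lambda>k. (K \<epsilon> n k - K 0 n k) * u k) has_sum
          resolvent V (Complex \<omega> (s * \<epsilon>)) u n - R u n) UNIV"
        by (simp add: res[OF e(2) u] left_diff_distrib)
      then show "resolvent V (Complex \<omega> (s * \<epsilon>)) u n - R u n = (\<Sum>\<^sub>\<infinity>k. (K \<epsilon> n k - K 0 n k) * u k)"
        by (rule infsumI[symmetric])
    qed
    moreover have "cmod (K \<epsilon> n k - K 0 n k) \<le> B + B" for n k
      using norm_triangle_ineq4[of "K \<epsilon> n k" "K 0 n k"] K[OF e(1), of n k] K[of 0 n k] by simp
    ultimately show ?thesis
      using kernel_op_bounded_ops(2,3)[OF \<sigma>, of "\<lambda>n k. K \<epsilon> n k - K 0 n k" "B + B"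
          "\<lambda>u n. resolvent V (Complex \<omega> (s * \<epsilon>)) u n - R u n"] by blast
  qed
  have "continuous_on {0..1} (\<lambda>\<epsilon>. sqrt (hs_sq \<sigma> (\<lambda>n k. K \<epsilon> n k - K 0 n k)))"
  proof (intro continuous_intros continuous_on_hs_sq[OF \<sigma>, of _ _ "B + B"] cK)
    show "cmod (K \<epsilon> n k - K 0 n k) \<le> B + B" if "\<epsilon> \<in> {0..1}" for \<epsilon> n k
      using norm_triangle_ineq4[of "K \<epsilon> n k" "K 0 n k"] K[OF that, of n k] K[of 0 n k] by simp
  qed
  then have "((\<lambda>\<epsilon>. sqrt (hs_sq \<sigma> (\<lambda>n k. K \<epsilon> n k - K 0 n k)))
      \<longlongrightarrow> sqrt (hs_sq \<sigma> (\<lambda>n k. K 0 n k - K 0 n k))) (at 0 within {0..1})"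
    unfolding continuous_on_def by (rule bspec) simp
  \<comment> \<open>At \<open>\<epsilon> = 0\<close> the difference kernel vanishes, so continuity
    of its Hilbert-Schmidt norm makes the limit 0.\<close>
  then have lim: "((\<lambda>\<epsilon>. sqrt (hs_sq \<sigma> (\<lambda>n k. K \<epsilon> n k - K 0 n k))) \<longlongrightarrow> 0) (at_right 0)"
    by (simp add: at_within_Icc_at_right hs_sq_def case_prod_unfold)
  have "((\<lambda>\<epsilon>. op_norm \<sigma> (-\<sigma>) (\<lambda>u n. resolvent V (Complex \<omega> (s * \<epsilon>)) u n - R u n))
      \<longlongrightarrow> 0) (at_right 0)"
  proof (rule tendsto_sandwich[OF _ _ tendsto_const lim])
    have "\<forall>\<^sub>F \<epsilon> in at_right 0. \<epsilon> \<in> {0<..(1 :: real)}"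
      by (rule eventually_at_rightI[of 0 1]) auto
    then show "\<forall>\<^sub>F \<epsilon> in at_right 0. 0 \<le> op_norm \<sigma> (- \<sigma>) (\<lambda>u n. resolvent V (Complex \<omega> (s * \<epsilon>)) u n - R u n)"
      "\<forall>\<^sub>F \<epsilon> in at_right 0. op_norm \<sigma> (- \<sigma>) (\<lambda>u n. resolvent V (Complex \<omega> (s * \<epsilon>)) u n - R u n)
        \<le> sqrt (hs_sq \<sigma> (\<lambda>n k. K \<epsilon> n k - K 0 n k))"
      by (eventually_elim; use diff in blast)+
  qed
  \<comment> \<open>The kernels share the bound \<open>B\<close>, so their Hilbert-Schmidt norms are
    bounded by one number free of \<open>\<epsilon>\<close>.\<close>
  moreover have "bdd_above ((\<lambda>\<epsilon>. op_norm \<sigma> (- \<sigma>) (resolvent V (Complex \<omega> (s * \<epsilon>)))) ` {0<..1})"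
  proof (rule bdd_aboveI2)
    show "op_norm \<sigma> (- \<sigma>) (resolvent V (Complex \<omega> (s * \<epsilon>)))
        \<le> sqrt (\<Sum>\<^sub>\<infinity>(n, k). (1 + (real_of_int n)\<^sup>2) powr (- \<sigma>) * (1 + (real_of_int k)\<^sup>2) powr (- \<sigma>) * B\<^sup>2)"
      if "\<epsilon> \<in> {0<..1}" for \<epsilon>
      by (rule order_trans[OF norm[OF that] real_sqrt_le_mono[OF hs_sq_le[OF \<sigma> K]]])
        (use that in auto)
  qed
  ultimately show ?thesis using bounded R by blast
qed

end
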